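(* For all positive integers $n$, $$\mathtt{MCG}(\beta(n,n,\infty))=\Omega\left(\frac{\beta(n,n,\infty)}{n\log n}\right).$$
   Context: Directed multicut: given a directed graph $G=(V,E)$ and demand pairs $P\subseteq V\times V$, $\textsc{MCut}(G,P)$ is the minimum number of edges whose removal leaves no $s\leadsto t$ path for every $(s,t)\in P$. Maximum multicommodity flow: with unit capacity on every edge, choose for each $(s_i,t_i)\in P$ a flow from $s_i$ to $t_i$ (conserved at all other nodes) such that the sum of all flows on each edge is at most $1$; $\textsc{MMFlow}(G,P)$ is the maximum possible sum of the flow values. $\mathtt{MCG}(N)$ is the least integer $k$ such that for every $N$-node directed graph $G$ and every set of demand pairs $P$ (of any size), $\textsc{MCut}(G,P)\le k\cdot\textsc{MMFlow}(G,P)$. A path system is $S=(V,\Pi)$ with $V$ a finite set of nodes and $\Pi$ a multiset of node sequences (paths), each containing each node at most once; size $\|S\|=\sum_\pi|\pi|$ ($|\pi|$ = number of nodes). Write $x<_\pi y$ if $x$ strictly precedes $y$ in $\pi$. A $b$-bridge: $b$ distinct nodes $v_1,\dots,v_b$ and $b$ distinct paths $\pi_1,\dots,\pi_b$ with $v_i<_{\pi_i}v_{i+1}$ ($1\le i\le b-1$) and $v_1<_{\pi_b}v_b$. Bridge girth = least $b$ admitting a $b$-bridge ($\infty$ if none). $\beta(n,p,k)$ = maximum size of a path system with $n$ nodes, $p$ paths and bridge girth $>k$. *)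

theory Defs
  imports Complex_Main "HOL-Library.Landau_Symbols" "HOL-Library.Extended_Nat"
begin

section \<open>Path systems, bridges and beta\<close>

text \<open>A path is a node list without repetitions; x strictly precedes y on path.\<close>
definition prec :: "nat list \<Rightarrow> nat \<Rightarrow> nat \<Rightarrow> bool" where
  "prec path x y \<longleftrightarrow> (\<exists>a c. a < c \<and> c < length path \<and> path ! a = x \<and> path ! c = y)"

text \<open>A path system (V, Pi): V a finite node set, Pi a multiset of paths,
  represented as a list (order irrelevant, repetitions allowed).\<close>
definition path_system :: "nat set \<Rightarrow> nat list list \<Rightarrow> bool" where
  "path_system V Pi \<longleftrightarrow> finite V \<and> (\<forall>path \<in> set Pi. distinct path \<and> set path \<subseteq> V)"

definition ps_size :: "nat list list \<Rightarrow> nat" where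
  "ps_size Pi = (\<Sum>path \<leftarrow> Pi. length path)"

text \<open>A b-bridge (0-indexed): distinct nodes v 0, ..., v (b-1) and distinct paths
  (distinct positions idx 0, ..., idx (b-1) in the multiset) with
  v j before v (j+1) on path idx j for j < b-1, and v 0 before v (b-1) on path idx (b-1).\<close>
definition has_bridge :: "nat list list \<Rightarrow> nat \<Rightarrow> bool" where
  "has_bridge Pi b \<longleftrightarrow> 1 \<le> b \<and> (\<exists>v idx.
      inj_on v {..<b} \<and> inj_on idx {..<b} \<and> (\<forall>j<b. idx j < length Pi) \<and>
      (\<forall>j. j + 1 < b \<longrightarrow> prec (Pi ! idx j) (v j) (v (j + 1))) \<and>
      prec (Pi ! idx (b - 1)) (v 0) (v (b - 1)))"

text \<open>Bridge girth > k: no b-bridge with b \<le> k.  Bridge girth = infinity: no bridge at all.\<close>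
definition bridge_girth_gt :: "nat list list \<Rightarrow> enat \<Rightarrow> bool" where
  "bridge_girth_gt Pi k \<longleftrightarrow> (\<forall>b. enat b \<le> k \<longrightarrow> \<not> has_bridge Pi b)"

definition beta :: "nat \<Rightarrow> nat \<Rightarrow> enat \<Rightarrow> nat" where
  "beta n p k = Sup {ps_size Pi | V Pi. path_system V Pi \<and> card V = n \<and> length Pi = p
                                        \<and> bridge_girth_gt Pi k}"

section \<open>Directed multicut and multicommodity flow\<close>

definition digraph :: "nat set \<Rightarrow> (nat \<times> nat) set \<Rightarrow> bool" where
  "digraph V E \<longleftrightarrow> finite V \<and> E \<subseteq> V \<times> V"

text \<open>Demand pairs: ordered pairs of distinct nodes.\<close>
definition demands :: "nat set \<Rightarrow> (nat \<times> nat) set \<Rightarrow> bool" where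
  "demands V P \<longleftrightarrow> P \<subseteq> V \<times> V \<and> (\<forall>(s,t)\<in>P. s \<noteq> t)"

definition is_multicut :: "(nat \<times> nat) set \<Rightarrow> (nat \<times> nat) set \<Rightarrow> (nat \<times> nat) set \<Rightarrow> bool" where
  "is_multicut E P C \<longleftrightarrow> C \<subseteq> E \<and> (\<forall>(s,t)\<in>P. (s,t) \<notin> (E - C)\<^sup>*)"

definition MCut :: "(nat \<times> nat) set \<Rightarrow> (nat \<times> nat) set \<Rightarrow> nat" where
  "MCut E P = Inf {card C | C. is_multicut E P C}"

definition inflow :: "(nat \<times> nat) set \<Rightarrow> ((nat \<times> nat) \<Rightarrow> real) \<Rightarrow> nat \<Rightarrow> real" where
  "inflow E f v = (\<Sum>e\<in>{e\<in>E. snd e = v}. f e)"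

definition outflow :: "(nat \<times> nat) set \<Rightarrow> ((nat \<times> nat) \<Rightarrow> real) \<Rightarrow> nat \<Rightarrow> real" where
  "outflow E f v = (\<Sum>e\<in>{e\<in>E. fst e = v}. f e)"

text \<open>A (single-commodity) flow from s to t: nonnegative on edges, conserved at all
  nodes other than s and t; its value is the net outflow at s.\<close>
definition is_flow :: "(nat \<times> nat) set \<Rightarrow> nat \<Rightarrow> nat \<Rightarrow> ((nat \<times> nat) \<Rightarrow> real) \<Rightarrow> bool" where
  "is_flow E s t f \<longleftrightarrow> (\<forall>e\<in>E. 0 \<le> f e) \<and>
     (\<forall>v. v \<noteq> s \<and> v \<noteq> t \<longrightarrow> inflow E f v = outflow E f v)"

definition flow_value :: "(nat \<times> nat) set \<Rightarrow> nat \<Rightarrow> ((nat \<times> nat) \<Rightarrow> real) \<Rightarrow> real" where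
  "flow_value E s f = outflow E f s - inflow E f s"

text \<open>Multicommodity flow with unit edge capacities: one flow F (s,t) per demand pair.\<close>
definition is_mcflow :: "(nat \<times> nat) set \<Rightarrow> (nat \<times> nat) set \<Rightarrow>
    ((nat \<times> nat) \<Rightarrow> (nat \<times> nat) \<Rightarrow> real) \<Rightarrow> bool" where
  "is_mcflow E P F \<longleftrightarrow> (\<forall>(s,t)\<in>P. is_flow E s t (F (s,t))) \<and>
     (\<forall>e\<in>E. (\<Sum>q\<in>P. F q e) \<le> 1)"

definition MMFlow :: "(nat \<times> nat) set \<Rightarrow> (nat \<times> nat) set \<Rightarrow> real" where
  "MMFlow E P = Sup {(\<Sum>q\<in>P. flow_value E (fst q) (F q)) | F. is_mcflow E P F}"

definition MCG :: "nat \<Rightarrow> nat" where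
  "MCG N = (LEAST k::nat. \<forall>V E P. digraph V E \<and> card V = N \<and> demands V P \<longrightarrow>
              real (MCut E P) \<le> real k * MMFlow E P)"

end

theory Submission
  imports Defs "HOL-Library.FuncSet" "HOL-Real_Asymp.Real_Asymp"
begin

text \<open>
  Take an extremal bridgeless system on \<open>n\<close> nodes and \<open>n\<close> paths and let \<open>L\<close> be about \<open>log n\<close>.

  Deleting some node occurrences makes it acyclic while a \<open>1/(2L)\<close> fraction of its size survives.
  First restrict to a dyadic degree class, then split the node set recursively along cuts that are
  sparse compared with the degree. If no sparse cut exists, the forward closure of \<open>u\<close> and the
  backward closure of \<open>v\<close> expand, for any \<open>u\<close> before \<open>v\<close> on some path; growing them through disjoint
  classes of paths makes both exceed half of the nodes, so that they meet, and the resulting walk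
  from \<open>u\<close> to \<open>v\<close> uses distinct paths, which is a bridge. This needs the average degree to exceed a
  fixed power of \<open>L\<close>; an explicit parabola construction shows that it is even a power of \<open>n\<close>.

  The acyclic system of size \<open>M\<close> is turned into a graph with one unit-capacity bottleneck edge per
  node occurrence and one demand pair per path. Each path assigns a random level below
  \<open>l \<approx> M/(32 n)\<close> to every bottleneck, and may move from one bottleneck to a later one only by
  raising the level by one, so it must cross \<open>l\<close> bottlenecks. Any \<open>M/8\<close> edges leave some pair
  connected, by a union bound over all cuts. Conversely, bridgelessness and acyclicity make the
  paths convex, which yields for every pair a potential showing that all its routes in the whole
  graph cross \<open>l\<close> bottlenecks; hence the flow is at most \<open>M/l\<close> and the gap at least \<open>l/8\<close>.
\<close>

section \<open>Bridgeless path systems\<close>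

lemma prec_Cons: "prec (a # xs) x y \<longleftrightarrow> x = a \<and> y \<in> set xs \<or> prec xs x y"
proof
  assume "prec (a # xs) x y"
  then obtain i j where ij: "i < j" "j < Suc (length xs)" "(a # xs) ! i = x" "(a # xs) ! j = y"
    by (auto simp: prec_def)
  obtain j' where j': "j = Suc j'" using ij by (cases j) auto
  show "x = a \<and> y \<in> set xs \<or> prec xs x y"
  proof (cases i)
    case 0 then show ?thesis using ij j' by auto
  next
    case (Suc i')
    then have "i' < j'" "j' < length xs" "xs ! i' = x" "xs ! j' = y" using ij j' by auto
    then show ?thesis unfolding prec_def by blast
  qed
next
  assume "x = a \<and> y \<in> set xs \<or> prec xs x y"
  then show "prec (a # xs) x y"
  proof
    assume "x = a \<and> y \<in> set xs"
    then obtain j where "j < length xs" "xs ! j = y" "x = a" by (auto simp: in_set_conv_nth)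
    then show ?thesis unfolding prec_def by (intro exI[of _ 0] exI[of _ "Suc j"]) auto
  next
    assume "prec xs x y"
    then obtain i j where "i < j" "j < length xs" "xs ! i = x" "xs ! j = y" by (auto simp: prec_def)
    then show ?thesis unfolding prec_def by (intro exI[of _ "Suc i"] exI[of _ "Suc j"]) auto
  qed
qed

lemma prec_Nil [simp]: "\<not> prec [] x y"
  by (simp add: prec_def)

lemma prec_in_set: "prec xs x y \<Longrightarrow> x \<in> set xs \<and> y \<in> set xs"
  by (auto simp: prec_def)

lemma prec_neq: "distinct xs \<Longrightarrow> prec xs x y \<Longrightarrow> x \<noteq> y"
  by (auto simp: prec_def nth_eq_iff_index_eq)

lemma prec_filter: "prec (filter P xs) x y \<Longrightarrow> prec xs x y"
proof (induction xs)
  case (Cons a xs)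
  then show ?case by (cases "P a") (auto simp: prec_Cons)
qed simp

lemma prec_filterD: "prec (filter P xs) x y \<Longrightarrow> P x \<and> P y"
  using prec_in_set by fastforce

lemma prec_take: "prec (take m xs) x y \<Longrightarrow> prec xs x y"
  unfolding prec_def by (metis length_take min_less_iff_conj nth_take order_less_trans)

lemma prec_total: "x \<in> set xs \<Longrightarrow> y \<in> set xs \<Longrightarrow> x \<noteq> y \<Longrightarrow> prec xs x y \<or> prec xs y x"
  by (induction xs) (auto simp: prec_Cons)

section \<open>Bridges as walks along distinct paths, closed by a chord\<close>

definition bridgeless :: "nat list list \<Rightarrow> bool" where
  "bridgeless Ps \<longleftrightarrow> (\<forall>b. \<not> has_bridge Ps b)"

lemma bridge_girth_infinity: "bridge_girth_gt Ps \<infinity> \<longleftrightarrow> bridgeless Ps"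
  by (simp add: bridge_girth_gt_def bridgeless_def)

text \<open>The hops become the first \<open>m\<close> paths of the bridge and the chord
  \<open>t\<close> the last one; hence the length \<open>Suc m\<close>.\<close>

lemma has_bridge_if_walk:
  assumes "inj_on vs {..m}" "inj_on ks {..<m}" "0 < m"
    and "\<And>j. j < m \<Longrightarrow> ks j < length Ps \<and> ks j \<noteq> t \<and> prec (Ps ! ks j) (vs j) (vs (Suc j))"
    and "t < length Ps" "prec (Ps ! t) (vs 0) (vs m)"
  shows "has_bridge Ps (Suc m)"
proof -
  define idx where "idx = (\<lambda>j. if j < m then ks j else t)"
  have inj: "inj_on idx {..<Suc m}"
  proof (rule inj_onI)
    fix x y assume xy: "x \<in> {..<Suc m}" "y \<in> {..<Suc m}" "idx x = idx y"
    consider "x < m" "y < m" | "x < m" "y = m" | "x = m" "y < m" | "x = m" "y = m"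
      using xy by force
    then show "x = y"
    proof cases
      case 1 then show ?thesis using xy assms(2) by (auto simp: idx_def inj_on_def)
    next
      case 2 then show ?thesis using xy(3) assms(4)[of x] by (auto simp: idx_def)
    next
      case 3 then show ?thesis using xy(3) assms(4)[of y] by (auto simp: idx_def)
    qed auto
  qed
  have e: "{..<Suc m} = {..m}" by auto
  have "inj_on vs {..<Suc m} \<and> inj_on idx {..<Suc m} \<and> (\<forall>j<Suc m. idx j < length Ps) \<and>
      (\<forall>j. j + 1 < Suc m \<longrightarrow> prec (Ps ! idx j) (vs j) (vs (j + 1))) \<and>
      prec (Ps ! idx (Suc m - 1)) (vs 0) (vs (Suc m - 1))"
    using assms inj e by (auto simp: idx_def)
  then show ?thesis unfolding has_bridge_def by (intro conjI) (simp, blast)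
qed

text \<open>A repeated node bounds a closed part of the walk, which can be cut out: the ends and the
  distinctness of the paths survive, so induction on the length reduces to distinct nodes. Since the
  ends differ, the walk never shrinks to nothing.\<close>

lemma bridgeless_no_rainbow_walk:
  assumes "bridgeless Ps" "t < length Ps"
  shows "\<lbrakk>inj_on ks {..<m};
    \<And>j. j < m \<Longrightarrow> ks j < length Ps \<and> ks j \<noteq> t \<and> prec (Ps ! ks j) (vs j) (vs (Suc j));
    prec (Ps ! t) (vs 0) (vs m); vs 0 \<noteq> vs m\<rbrakk> \<Longrightarrow> False"
proof (induction m arbitrary: ks vs rule: less_induct)
  case (less m)
  show False
  proof (cases "inj_on vs {..m}")
    case True
    have "0 < m" using less.prems(4) by (cases m) auto
    then have "has_bridge Ps (Suc m)"
      using has_bridge_if_walk[OF True less.prems(1) _ less.prems(2) assms(2) less.prems(3)] by blast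
    then show False using assms(1) by (simp add: bridgeless_def)
  next
    case False
    then obtain a c where ac: "a < c" "c \<le> m" "vs a = vs c"
      unfolding inj_on_def by (metis atMost_iff linorder_neqE_nat)
    define d where "d = c - a"
    have d: "0 < d" "a + d = c" using ac by (auto simp: d_def)
    define ws where "ws = (\<lambda>j. if j \<le> a then vs j else vs (j + d))"
    define ls where "ls = (\<lambda>j. if j < a then ks j else ks (j + d))"
    \<comment> \<open>At \<open>j = a\<close> both branches agree because
      \<open>vs a = vs c\<close>; this second form matches the case split of
      \<open>ls\<close>.\<close>
    have ws': "ws j = (if j < a then vs j else vs (j + d))" for j
      using ac d by (cases "j = a") (auto simp: ws_def)
    have "m - d < m" using d ac by auto
    moreover have "inj_on ls {..<m - d}"
      using less.prems(1) d ac unfolding inj_on_def ls_def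
      by (smt (verit) add_diff_cancel_right' lessThan_iff less_diff_conv not_less trans_less_add1 less_add_same_cancel1 le_add_diff_inverse2)
    moreover have "ls j < length Ps \<and> ls j \<noteq> t \<and> prec (Ps ! ls j) (ws j) (ws (Suc j))" if "j < m - d" for j
    proof (cases "j < a")
      case True
      then have "j < m" "Suc j \<le> a" using ac by auto
      then show ?thesis using less.prems(2)[of j] True by (auto simp: ls_def ws_def)
    next
      case False
      have "j + d < m" using that by auto
      then show ?thesis using less.prems(2)[of "j + d"] False by (auto simp: ls_def ws')
    qed
    moreover have "ws 0 = vs 0" by (simp add: ws_def)
    moreover have "ws (m - d) = vs m" using ac d by (auto simp: ws' )
    ultimately show False using less.IH[of "m - d" ls ws] less.prems(3,4) by auto
  qed
qed

section \<open>A polynomial lower bound for beta\<close>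

lemma ps_size_le:
  assumes "path_system V Ps"
  shows "ps_size Ps \<le> length Ps * card V"
proof -
  have "length xs \<le> card V" if "xs \<in> set Ps" for xs
    using assms that unfolding path_system_def by (metis card_mono distinct_card)
  then show ?thesis
    unfolding ps_size_def using sum_list_mono[of Ps length "\<lambda>_. card V"]
    by (simp add: sum_list_triv)
qed

lemma beta_set_finite:
  "finite {ps_size Ps | V Ps. path_system V Ps \<and> card V = n \<and> length Ps = p \<and> bridge_girth_gt Ps k}"
  by (rule finite_subset[of _ "{..p * n}"]) (use ps_size_le in auto)

lemma ps_size_le_beta:
  assumes "path_system V Ps" "card V = n" "length Ps = p" "bridge_girth_gt Ps k"
  shows "ps_size Ps \<le> beta n p k"
  unfolding beta_def using assms beta_set_finite[of n p k]
  by (intro cSup_upper bdd_above_finite) auto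

lemma bridgeless_replicate_Nil: "bridgeless (replicate p [])"
  unfolding bridgeless_def has_bridge_def
  by (metis One_nat_def diff_less less_le_trans length_replicate lessI nth_replicate prec_Nil zero_less_one)

text \<open>A list of empty paths makes the set of sizes nonempty and \<open>ps_size_le\<close>
  bounds it, so the supremum is a maximum.\<close>

lemma beta_attained:
  obtains V Ps where "path_system V Ps" "card V = n" "length Ps = p" "bridgeless Ps"
    "ps_size Ps = beta n p \<infinity>"
proof -
  let ?A = "{ps_size Ps | V Ps. path_system V Ps \<and> card V = n \<and> length Ps = p \<and> bridge_girth_gt Ps \<infinity>}"
  have "path_system {..<n} (replicate p [])" by (auto simp: path_system_def)
  then have mem: "ps_size (replicate p []) \<in> ?A"
    using bridgeless_replicate_Nil[of p]
    by (intro CollectI exI[of _ "replicate p []"] exI[of _ "{..<n}"]) (auto simp: bridge_girth_infinity)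
  from mem have "Max ?A \<in> ?A" using beta_set_finite by (intro Max_in) auto
  moreover have "Max ?A = beta n p \<infinity>"
    unfolding beta_def using mem beta_set_finite[of n p \<infinity>] by (subst cSup_eq_Max) auto
  ultimately show ?thesis using that by (auto simp: bridge_girth_infinity)
qed

section \<open>Parabola paths: a bridgeless system of polynomial density\<close>

definition enc :: "nat \<Rightarrow> nat \<Rightarrow> nat \<Rightarrow> nat \<Rightarrow> nat" where
  "enc q j x y = j + q * (x + 8 * q ^ 2 * y)"

definition slope :: "nat \<Rightarrow> nat \<Rightarrow> nat" where
  "slope q i = i mod (4 * q)"

definition xstart :: "nat \<Rightarrow> nat \<Rightarrow> nat" where
  "xstart q i = (i div (4 * q)) mod (4 * q ^ 2)"

definition ystart :: "nat \<Rightarrow> nat \<Rightarrow> nat" where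
  "ystart q i = i div (4 * q) div (4 * q ^ 2)"

text \<open>
  The layered points \<open>(j, x + j t, y + j t\<^sup>2)\<close>, \<open>j < q\<close>, where \<open>i\<close> encodes \<open>(t, x, y)\<close>. For a bridge made of
  steps of lengths \<open>k\<^sub>j\<close> and slopes \<open>t\<^sub>j\<close> closed by slope \<open>t\<close>, the three coordinates force
  \<open>\<Sum>k\<^sub>j (t\<^sub>j - t)\<^sup>2 = 0\<close>, so all paths coincide.
\<close>

definition parabola :: "nat \<Rightarrow> nat \<Rightarrow> nat list" where
  "parabola q i = map (\<lambda>j. enc q j (xstart q i + j * slope q i) (ystart q i + j * slope q i ^ 2)) [0..<q]"

lemma parabola_index: "i = slope q i + 4 * q * (xstart q i + 4 * q ^ 2 * ystart q i)"
  unfolding slope_def xstart_def ystart_def by (metis mod_mult_div_eq mult_div_mod_eq)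

lemma enc_decode:
  assumes "j < q" "x < 8 * q ^ 2"
  shows "enc q j x y mod q = j" "(enc q j x y div q) mod (8 * q ^ 2) = x" "enc q j x y div q div (8 * q ^ 2) = y"
  using assms by (auto simp: enc_def)

text \<open>Slopes below \<open>4 * q\<close> shift the coordinates by at most
  \<open>4 * q ^ 2\<close> and \<open>16 * q ^ 3\<close>, which are the ranges of the two starts.
  Doubled ranges therefore suffice, and the path indices and the node codes both range below
  \<open>256 * q ^ 6\<close>.\<close>

lemma parabola_bounds:
  assumes "j < q" "i < 256 * q ^ 6"
  shows "xstart q i + j * slope q i < 8 * q ^ 2" "ystart q i + j * slope q i ^ 2 < 32 * q ^ 3"
proof -
  have q: "0 < q" using assms by auto
  have s: "slope q i < 4 * q" using q by (simp add: slope_def)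
  have x: "xstart q i < 4 * q ^ 2" using q by (simp add: xstart_def)
  have "j * slope q i \<le> q * (4 * q)" using assms(1) s by (intro mult_mono) auto
  then show "xstart q i + j * slope q i < 8 * q ^ 2" using x by (simp add: power2_eq_square)
  have "i < (16 * q ^ 3) * (4 * q ^ 2) * (4 * q)" using assms(2) by (simp add: power_numeral_reduce)
  then have y: "ystart q i < 16 * q ^ 3" unfolding ystart_def
    using q by (simp add: less_mult_imp_div_less)
  have "slope q i ^ 2 \<le> (4 * q) ^ 2" using s by (intro power_mono) auto
  then have "j * slope q i ^ 2 \<le> q * (4 * q) ^ 2" using assms(1) by (intro mult_mono) auto
  then show "ystart q i + j * slope q i ^ 2 < 32 * q ^ 3" using y by (simp add: power_numeral_reduce)
qed

lemma enc_less:
  assumes "j < q" "x < 8 * q ^ 2" "y < 32 * q ^ 3"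
  shows "enc q j x y < 256 * q ^ 6"
proof -
  have "x + 8 * q ^ 2 * y < 8 * q ^ 2 * (32 * q ^ 3)"
  proof -
    have "x + 8 * q ^ 2 * y < 8 * q ^ 2 * Suc y" using assms(2) by simp
    also have "\<dots> \<le> 8 * q ^ 2 * (32 * q ^ 3)" using assms(3) by (intro mult_left_mono) auto
    finally show ?thesis .
  qed
  then have "q * Suc (x + 8 * q ^ 2 * y) \<le> q * (8 * q ^ 2 * (32 * q ^ 3))" by (intro mult_left_mono) auto
  then show ?thesis using assms(1) by (simp add: enc_def power_numeral_reduce)
qed

lemma prec_parabola:
  assumes "prec (parabola q i) u v" "i < 256 * q ^ 6"
  defines "a \<equiv> int (u mod q)" and "b \<equiv> int (v mod q)" and "t \<equiv> int (slope q i)"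
  shows "a < b"
    and "int (u div q mod (8 * q ^ 2)) = int (xstart q i) + a * t"
    and "int (v div q mod (8 * q ^ 2)) = int (xstart q i) + b * t"
    and "int (u div q div (8 * q ^ 2)) = int (ystart q i) + a * t ^ 2"
    and "int (v div q div (8 * q ^ 2)) = int (ystart q i) + b * t ^ 2"
proof -
  obtain j k where jk: "j < k" "k < q"
    "u = enc q j (xstart q i + j * slope q i) (ystart q i + j * slope q i ^ 2)"
    "v = enc q k (xstart q i + k * slope q i) (ystart q i + k * slope q i ^ 2)"
    using assms(1) by (auto simp: prec_def parabola_def)
  have j: "j < q" using jk by simp
  note dj = enc_decode[OF j parabola_bounds(1)[OF j assms(2)]]
  note dk = enc_decode[OF jk(2) parabola_bounds(1)[OF jk(2) assms(2)]]
  show "a < b" "int (u div q mod (8 * q ^ 2)) = int (xstart q i) + a * t"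
    "int (v div q mod (8 * q ^ 2)) = int (xstart q i) + b * t"
    "int (u div q div (8 * q ^ 2)) = int (ystart q i) + a * t ^ 2"
    "int (v div q div (8 * q ^ 2)) = int (ystart q i) + b * t ^ 2"
    using jk(1) by (auto simp: a_def b_def t_def jk(3,4) dj dk)
qed

lemma parabolas_bridgeless:
  "bridgeless (map (parabola q) [0..<256 * q ^ 6] @ replicate r [])" (is "bridgeless ?Ps")
proof -
  let ?N = "256 * q ^ 6"
  have nth: "i < ?N \<and> prec (parabola q i) x y" if "prec (?Ps ! i) x y" "i < length ?Ps" for i x y
  proof (cases "i < ?N")
    case False
    then have "?Ps ! i = []" using that(2) by (simp add: nth_append)
    then show ?thesis using that by simp
  qed (use that in \<open>simp add: nth_append\<close>)
  have False if br: "has_bridge ?Ps b" for b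
  proof -
    obtain v idx where b: "1 \<le> b" and idx: "inj_on idx {..<b}" and len: "\<And>j. j < b \<Longrightarrow> idx j < length ?Ps"
      and hop0: "\<And>j. j + 1 < b \<Longrightarrow> prec (?Ps ! idx j) (v j) (v (j + 1))"
      and ch0: "prec (?Ps ! idx (b - 1)) (v 0) (v (b - 1))"
      using br unfolding has_bridge_def by blast
    have hop: "idx j < ?N" "prec (parabola q (idx j)) (v j) (v (Suc j))" if j: "j < b - 1" for j
    proof -
      have "prec (?Ps ! idx j) (v j) (v (Suc j))" "idx j < length ?Ps"
        using hop0[of j] len[of j] j by auto
      then show "idx j < ?N" "prec (parabola q (idx j)) (v j) (v (Suc j))" using nth by blast+
    qed
    have ch: "idx (b - 1) < ?N" "prec (parabola q (idx (b - 1))) (v 0) (v (b - 1))"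
      using nth[OF ch0 len] b by auto
    define A where "A = (\<lambda>j. int (v j mod q))"
    define X where "X = (\<lambda>j. int (v j div q mod (8 * q ^ 2)))"
    define Y where "Y = (\<lambda>j. int (v j div q div (8 * q ^ 2)))"
    define s where "s = (\<lambda>j. int (slope q (idx j)))"
    define t where "t = s (b - 1)"
    have A: "A j < A (Suc j)" "X (Suc j) - X j = (A (Suc j) - A j) * s j"
      "Y (Suc j) - Y j = (A (Suc j) - A j) * s j ^ 2" if "j < b - 1" for j
      using prec_parabola[OF hop(2,1)[OF that]] by (auto simp: A_def X_def Y_def s_def algebra_simps)
    have C: "A 0 < A (b - 1)" "X (b - 1) - X 0 = (A (b - 1) - A 0) * t"
      "Y (b - 1) - Y 0 = (A (b - 1) - A 0) * t ^ 2"
      using prec_parabola[OF ch(2,1)] by (auto simp: A_def X_def Y_def s_def t_def algebra_simps)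
    have b1: "0 < b - 1" using C(1) by (cases "b - 1") auto
    \<comment> \<open>Expanding the square leaves increments of \<open>Y\<close>, \<open>X\<close>
      and \<open>A\<close>. Each telescopes to the increment of the chord, for which the same
      combination is zero.\<close>
    have "(\<Sum>j<b - 1. (A (Suc j) - A j) * (s j - t) ^ 2) =
        (\<Sum>j<b - 1. (Y (Suc j) - Y j) - 2 * t * (X (Suc j) - X j) + t ^ 2 * (A (Suc j) - A j))"
    proof (intro sum.cong)
      fix j assume "j \<in> {..<b - 1}"
      then have j: "j < b - 1" by simp
      show "(A (Suc j) - A j) * (s j - t) ^ 2
          = (Y (Suc j) - Y j) - 2 * t * (X (Suc j) - X j) + t ^ 2 * (A (Suc j) - A j)"
        unfolding A(2,3)[OF j] by (simp add: power2_eq_square algebra_simps)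
    qed simp
    also have "\<dots> = (\<Sum>j<b - 1. Y (Suc j) - Y j) - 2 * t * (\<Sum>j<b - 1. X (Suc j) - X j)
        + t ^ 2 * (\<Sum>j<b - 1. A (Suc j) - A j)"
      by (simp add: sum.distrib sum_subtractf right_diff_distrib sum_distrib_left)
    also have "\<dots> = (Y (b - 1) - Y 0) - 2 * t * (X (b - 1) - X 0) + t ^ 2 * (A (b - 1) - A 0)"
      by (simp only: sum_lessThan_telescope)
    also have "\<dots> = 0" unfolding C(2,3) by (simp add: power2_eq_square algebra_simps)
    finally have "(\<Sum>j<b - 1. (A (Suc j) - A j) * (s j - t) ^ 2) = 0" .
    \<comment> \<open>Layer increments are positive, so no summand is negative and all vanish; the
      first one gives the slope of hop 0.\<close>
    moreover have "\<And>j. j \<in> {..<b - 1} \<Longrightarrow> 0 \<le> (A (Suc j) - A j) * (s j - t) ^ 2"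
      using A(1) by (force intro: mult_nonneg_nonneg)
    ultimately have "(A (Suc 0) - A 0) * (s 0 - t) ^ 2 = 0"
      using b1 by (subst (asm) sum_nonneg_eq_0_iff) auto
    then have st: "s 0 = t" using A(1)[OF b1] by auto
    \<comment> \<open>Hop 0 and the chord share the node \<open>v 0\<close> and the slope, hence
      both starts, so they are the same path.\<close>
    have "int (xstart q (idx 0)) = int (xstart q (idx (b - 1)))"
      "int (ystart q (idx 0)) = int (ystart q (idx (b - 1)))"
      using prec_parabola(2,4)[OF hop(2,1)[OF b1]] prec_parabola(2,4)[OF ch(2,1)] st
      by (auto simp: s_def t_def)
    then have "idx 0 = idx (b - 1)"
      using parabola_index[of "idx 0" q] parabola_index[of "idx (b - 1)" q] st
      by (metis int_int_eq s_def t_def)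
    then show False using inj_onD[OF idx, of 0 "b - 1"] b1 by simp
  qed
  then show ?thesis by (auto simp: bridgeless_def)
qed

lemma beta_lower_bound:
  assumes "256 * q ^ 6 \<le> n"
  shows "256 * q ^ 7 \<le> beta n n \<infinity>"
proof -
  let ?N = "256 * q ^ 6"
  let ?Ps = "map (parabola q) [0..<?N] @ replicate (n - ?N) []"
  have "distinct (parabola q i) \<and> set (parabola q i) \<subseteq> {..<n}" if i: "i < ?N" for i
  proof
    show "distinct (parabola q i)" unfolding parabola_def distinct_map
    proof
      show "inj_on (\<lambda>j. enc q j (xstart q i + j * slope q i) (ystart q i + j * slope q i ^ 2)) (set [0..<q])"
      proof (rule inj_onI)
        fix j k assume "j \<in> set [0..<q]" "k \<in> set [0..<q]"
          and eq: "enc q j (xstart q i + j * slope q i) (ystart q i + j * slope q i ^ 2)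
            = enc q k (xstart q i + k * slope q i) (ystart q i + k * slope q i ^ 2)"
        then have jk: "j < q" "k < q" by auto
        show "j = k"
          using enc_decode(1)[OF jk(1) parabola_bounds(1)[OF jk(1) i]]
            enc_decode(1)[OF jk(2) parabola_bounds(1)[OF jk(2) i]] eq by metis
      qed
    qed simp
    show "set (parabola q i) \<subseteq> {..<n}"
    proof
      fix v assume "v \<in> set (parabola q i)"
      then obtain j where j: "j < q" "v = enc q j (xstart q i + j * slope q i) (ystart q i + j * slope q i ^ 2)"
        by (auto simp: parabola_def)
      then have "v < ?N" using enc_less[OF j(1) parabola_bounds[OF j(1) i]] by simp
      then show "v \<in> {..<n}" using assms by simp
    qed
  qed
  then have ps: "path_system {..<n} ?Ps" unfolding path_system_def by fastforce
  have "ps_size ?Ps = ?N * q"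
  proof -
    have "map length (map (parabola q) [0..<?N]) = map (\<lambda>_. q) [0..<?N]" by (simp add: parabola_def)
    then show ?thesis by (simp add: ps_size_def sum_list_replicate map_replicate_const sum_list_triv)
  qed
  moreover have "bridge_girth_gt ?Ps \<infinity>"
    using parabolas_bridgeless by (simp add: bridge_girth_infinity)
  moreover have "length ?Ps = n" using assms by simp
  ultimately have "?N * q \<le> beta n n \<infinity>" using ps_size_le_beta[OF ps, of n n \<infinity>] by simp
  moreover have "?N * q = 256 * q ^ 7" by (simp add: power_Suc2[symmetric] del: power_Suc)
  ultimately show ?thesis by simp
qed

section \<open>Robust level assignments\<close>

lemma exists_le_average:
  fixes g :: "'a \<Rightarrow> real"
  assumes "finite A" "A \<noteq> {}" "(\<Sum>h\<in>A. g h) \<le> real (card A) * c"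
  shows "\<exists>h\<in>A. g h \<le> c"
proof (rule ccontr)
  assume "\<not> ?thesis"
  then have "(\<Sum>h\<in>A. c) < (\<Sum>h\<in>A. g h)" using assms(1,2) by (intro sum_strict_mono) auto
  then show False using assms(3) by simp
qed

lemma two_mult_pred_power_le:
  assumes "0 < n"
  shows "2 * (n - 1) ^ n \<le> (n::nat) ^ n"
proof (cases "n = 1")
  case False
  define m where "m = n - 1"
  have m: "m \<ge> 1" "n = Suc m" using False assms by (auto simp: m_def)
  have "0 \<le> 1 / real m" by simp
  then have m1: "- 1 \<le> 1 / real m" by linarith
  have "2 \<le> 1 + real n * (1 / real m)" using m by (simp add: field_simps)
  also have "\<dots> \<le> (1 + 1 / real m) ^ n" using m1 by (rule Bernoulli_inequality)
  also have "1 + 1 / real m = real n / real m" using m by (simp add: field_simps)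
  finally have "2 * real m ^ n \<le> real n ^ n"
    using m(1) by (simp add: power_divide pos_le_divide_eq del: power_Suc)
  then show ?thesis unfolding m_def[symmetric]
    using of_nat_le_iff[of "2 * m ^ n" "n ^ n", where 'a=real] by simp
qed simp

lemma pred_power_le:
  assumes "4 * n \<le> u" "0 < n"
  shows "16 * (n - 1) ^ u \<le> (n::nat) ^ u"
proof -
  have "16 * (n - 1) ^ (4 * n) = (2 * (n - 1) ^ n) ^ 4"
    by (simp add: power_mult_distrib power_mult[symmetric] mult.commute)
  also have "\<dots> \<le> (n ^ n) ^ 4" by (intro power_mono two_mult_pred_power_le assms) auto
  finally have a: "16 * (n - 1) ^ (4 * n) \<le> n ^ (4 * n)" by (simp add: power_mult[symmetric] mult.commute)
  have u: "u = 4 * n + (u - 4 * n)" using assms by simp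
  have "16 * (n - 1) ^ u = (16 * (n - 1) ^ (4 * n)) * (n - 1) ^ (u - 4 * n)"
    by (subst u) (simp add: power_add)
  also have "\<dots> \<le> n ^ (4 * n) * n ^ (u - 4 * n)" by (intro mult_mono a power_mono) auto
  also have "\<dots> = n ^ u" using u by (metis power_add)
  finally show ?thesis .
qed

text \<open>A uniform level choice misses \<open>r\<close> on all of \<open>U\<close> with
  probability \<open>(1 - 1/n) ^ card U\<close>, and each of four blocks of \<open>n\<close>
  bottlenecks contributes a factor of at most 1/2.\<close>

lemma card_avoiding_functions:
  fixes B :: "'a set"
  assumes "finite B" "U \<subseteq> B" "4 * n \<le> card U" "r < n"
  shows "16 * card {h \<in> B \<rightarrow>\<^sub>E {..<n}. \<forall>b\<in>U. h b \<noteq> r} \<le> card (B \<rightarrow>\<^sub>E {..<n})"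
proof -
  have U: "finite U" using assms finite_subset by blast
  have "{h \<in> B \<rightarrow>\<^sub>E {..<n}. \<forall>b\<in>U. h b \<noteq> r} = (\<Pi>\<^sub>E b\<in>B. if b \<in> U then {..<n} - {r} else {..<n})"
    using assms(2) by (auto simp: PiE_iff extensional_def split: if_splits)
  then have "card {h \<in> B \<rightarrow>\<^sub>E {..<n}. \<forall>b\<in>U. h b \<noteq> r} = (\<Prod>b\<in>B. if b \<in> U then n - 1 else n)"
    using assms by (auto simp: card_PiE intro!: prod.cong)
  also have "\<dots> = (n - 1) ^ card U * n ^ card (B - U)"
    using assms U by (simp add: prod.If_cases Int_absorb1 Diff_eq)
  finally have "16 * card {h \<in> B \<rightarrow>\<^sub>E {..<n}. \<forall>b\<in>U. h b \<noteq> r} = (16 * (n - 1) ^ card U) * n ^ card (B - U)"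
    by simp
  also have "\<dots> \<le> n ^ card U * n ^ card (B - U)" using assms by (intro mult_right_mono pred_power_le) auto
  also have "\<dots> = card (B \<rightarrow>\<^sub>E {..<n})"
    using assms U by (simp add: card_PiE power_add[symmetric] card_Diff_subset card_mono)
  finally show ?thesis .
qed

text \<open>
  \<open>B v\<close> is the set of bottlenecks at node \<open>v\<close> and \<open>C\<close> the set of deleted ones: the level obtained by
  walking greedily along the path and climbing one level whenever a surviving bottleneck permits.
\<close>

primrec reach :: "(nat \<Rightarrow> nat set) \<Rightarrow> (nat \<Rightarrow> nat) \<Rightarrow> nat set \<Rightarrow> nat list \<Rightarrow> nat \<Rightarrow> nat" where
  "reach B f C [] r = r"
| "reach B f C (v # vs) r = reach B f C vs (if \<exists>b\<in>B v - C. f b = r then Suc r else r)"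

lemma reach_cong:
  "(\<And>v b. v \<in> set vs \<Longrightarrow> b \<in> B v \<Longrightarrow> f b = g b) \<Longrightarrow> reach B f C vs r = reach B g C vs r"
proof (induction vs arbitrary: r)
  case (Cons v vs)
  have "(\<exists>b\<in>B v - C. f b = r) \<longleftrightarrow> (\<exists>b\<in>B v - C. g b = r)"
    using Cons.prems[of v] by (metis DiffD1 list.set_intros(1))
  moreover have "reach B f C vs x = reach B g C vs x" for x
    by (rule Cons.IH) (use Cons.prems in auto)
  ultimately show ?case by simp
qed simp

text \<open>An exponential penalty for a walk standing at level \<open>r\<close>: a climb divides it
  by at least 16, it vanishes from level \<open>n\<close> on and exceeds 1 before, so it dominates
  the indicator of failure.\<close>

definition pot :: "nat \<Rightarrow> nat \<Rightarrow> real" where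
  "pot n r = (if r < n then 16 ^ (n - r) else 0)"

lemma pot_nonneg [simp]: "0 \<le> pot n r"
  by (simp add: pot_def)

lemma pot_Suc: "pot n (Suc r) \<le> pot n r / 16"
proof (cases "Suc r < n")
  case True
  then have "n - r = Suc (n - Suc r)" by simp
  then show ?thesis using True by (simp add: pot_def)
qed (simp add: pot_def)

text \<open>The threshold above which a random level choice misses a fixed level with probability at
  most 1/16.\<close>

definition good :: "(nat \<Rightarrow> nat set) \<Rightarrow> nat \<Rightarrow> nat set \<Rightarrow> nat \<Rightarrow> bool" where
  "good B n C v \<longleftrightarrow> 4 * n \<le> card (B v - C)"

text \<open>At a good node a miss has probability at most 1/16 and a climb divides the potential by
  16, together 1/8. At any other node the potential at least does not grow, and from level
  \<open>n\<close> on it is zero.\<close>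

lemma sum_pot_step:
  assumes "finite (B v)"
  shows "(\<Sum>h\<in>B v \<rightarrow>\<^sub>E {..<n}. pot n (if \<exists>b\<in>B v - C. h b = r then Suc r else r))
    \<le> real (card (B v \<rightarrow>\<^sub>E {..<n})) * (pot n r / (if good B n C v then 8 else 1))"
proof -
  let ?H = "B v \<rightarrow>\<^sub>E {..<n}" and ?P = "\<lambda>h. \<exists>b\<in>B v - C. h b = r"
  have fin: "finite ?H" using assms by (simp add: finite_PiE)
  have step: "pot n (if ?P h then Suc r else r) \<le> pot n r" for h
  proof -
    have "pot n (Suc r) \<le> pot n r" using pot_Suc[of n r] pot_nonneg[of n r] by linarith
    then show ?thesis by simp
  qed
  show ?thesis
  proof (cases "good B n C v \<and> r < n")
    case False
    have "pot n (if ?P h then Suc r else r) \<le> pot n r / (if good B n C v then 8 else 1)" for h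
      using False step[of h] by (auto simp: pot_def split: if_splits)
    then show ?thesis using sum_bounded_above by (metis (no_types, lifting))
  next
    case True
    let ?M = "{h \<in> ?H. \<forall>b\<in>B v - C. h b \<noteq> r}"
    have M: "16 * card ?M \<le> card ?H"
      using True assms by (intro card_avoiding_functions) (auto simp: good_def)
    have "(\<Sum>h\<in>?H. pot n (if ?P h then Suc r else r)) \<le> (\<Sum>h\<in>?H. (if h \<in> ?M then pot n r else 0) + pot n r / 16)"
      using pot_Suc[of n r] pot_nonneg[of n r] by (intro sum_mono) auto
    also have "\<dots> = real (card ?M) * pot n r + real (card ?H) * (pot n r / 16)"
    proof -
      have "(\<Sum>h\<in>?H. (if h \<in> ?M then pot n r else 0)) = (\<Sum>h\<in>?M. pot n r)"
        using fin by (intro sum.mono_neutral_cong_right) auto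
      then show ?thesis by (simp add: sum.distrib)
    qed
    also have "\<dots> \<le> (real (card ?H) / 16) * pot n r + real (card ?H) * (pot n r / 16)"
      using M by (intro add_right_mono mult_right_mono) auto
    finally show ?thesis using True by (simp add: mult.commute)
  qed
qed

text \<open>
  Method of conditional expectations: at a node that is good for \<open>C\<close>, a random level choice divides
  the potential of \<open>C\<close> by 8 on average.
\<close>

lemma level_assignment_path:
  fixes w :: "nat set \<Rightarrow> real"
  assumes CC: "finite CC" and B: "\<And>v. finite (B v)" and disj: "\<And>u v. u \<noteq> v \<Longrightarrow> B u \<inter> B v = {}"
    and n: "0 < n" and w: "\<And>C. C \<in> CC \<Longrightarrow> 0 \<le> w C"
  shows "distinct vs \<Longrightarrow> \<exists>f. (\<forall>b. f b < n) \<and>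
    (\<Sum>C | C \<in> CC \<and> reach B f C vs (rr C) < n. w C)
      \<le> (\<Sum>C\<in>CC. w C * (pot n (rr C) / 8 ^ length (filter (good B n C) vs)))"
proof (induction vs arbitrary: rr)
  case Nil
  have "(\<Sum>C | C \<in> CC \<and> rr C < n. w C) \<le> (\<Sum>C | C \<in> CC \<and> rr C < n. w C * pot n (rr C))"
  proof (rule sum_mono)
    fix C assume C: "C \<in> {C \<in> CC. rr C < n}"
    then have "w C * 1 \<le> w C * pot n (rr C)" using w by (intro mult_left_mono) (auto simp: pot_def)
    then show "w C \<le> w C * pot n (rr C)" by simp
  qed
  also have "\<dots> \<le> (\<Sum>C\<in>CC. w C * pot n (rr C))" using CC w by (intro sum_mono2) auto
  finally show ?case using n by (intro exI[of _ "\<lambda>_. 0"]) auto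
next
  case (Cons v vs)
  let ?H = "B v \<rightarrow>\<^sub>E {..<n}"
  define r' where "r' = (\<lambda>h C. if \<exists>b\<in>B v - C. h b = rr C then Suc (rr C) else rr C)"
  define c where "c = (\<lambda>C. w C / 8 ^ length (filter (good B n C) vs))"
  have c: "0 \<le> c C" if "C \<in> CC" for C using w[OF that] by (simp add: c_def)
  let ?g = "\<lambda>h. \<Sum>C\<in>CC. w C * (pot n (r' h C) / 8 ^ length (filter (good B n C) vs))"
  let ?K = "\<Sum>C\<in>CC. w C * (pot n (rr C) / 8 ^ length (filter (good B n C) (v # vs)))"
  have "(\<Sum>h\<in>?H. ?g h) = (\<Sum>C\<in>CC. c C * (\<Sum>h\<in>?H. pot n (r' h C)))"
    by (subst sum.swap) (simp add: c_def sum_distrib_left sum_divide_distrib)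
  also have "\<dots> \<le> (\<Sum>C\<in>CC. c C * (real (card ?H) * (pot n (rr C) / (if good B n C v then 8 else 1))))"
    unfolding r'_def using sum_pot_step[of B v n] B c by (intro sum_mono mult_left_mono) auto
  also have "\<dots> = real (card ?H) * ?K"
    unfolding sum_distrib_left by (intro sum.cong) (auto simp: c_def mult_ac)
  finally have "(\<Sum>h\<in>?H. ?g h) \<le> real (card ?H) * ?K" .
  moreover have "finite ?H" using B by (simp add: finite_PiE)
  moreover have "?H \<noteq> {}" using n by (auto simp: PiE_eq_empty_iff)
  ultimately obtain h where h: "h \<in> ?H" "?g h \<le> ?K" using exists_le_average[of ?H ?g ?K] by blast
  obtain f0 where f0: "\<forall>b. f0 b < n"
    "(\<Sum>C | C \<in> CC \<and> reach B f0 C vs (r' h C) < n. w C) \<le> ?g h"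
    using Cons.IH[of "r' h"] Cons.prems by auto
  \<comment> \<open>\<open>h\<close> decides the levels at \<open>v\<close> and \<open>f0\<close>
    those at later nodes. The path is distinct and the sets \<open>B\<close> are disjoint, so the
    rest of the walk does not notice \<open>h\<close>.\<close>
  define f where "f = (\<lambda>b. if b \<in> B v then h b else f0 b)"
  have "reach B f C (v # vs) (rr C) = reach B f0 C vs (r' h C)" for C
  proof -
    have "reach B f C vs x = reach B f0 C vs x" for x
    proof (rule reach_cong)
      fix u b assume "u \<in> set vs" "b \<in> B u"
      then have "b \<notin> B v" using disj[of u v] Cons.prems by auto
      then show "f b = f0 b" by (simp add: f_def)
    qed
    moreover have "(\<exists>b\<in>B v - C. f b = rr C) \<longleftrightarrow> (\<exists>b\<in>B v - C. h b = rr C)" by (auto simp: f_def)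
    ultimately show ?thesis by (simp add: r'_def)
  qed
  moreover have "\<forall>b. f b < n" using f0 h by (auto simp: f_def PiE_iff)
  ultimately show ?case using f0(2) h(2) by (intro exI[of _ f]) auto
qed

text \<open>The paths are treated one after the other. The factors expected from later paths are put
  into the weight of a cut, and only the cuts under which the current path fails are passed on. Each
  path starts with potential \<open>16 ^ n\<close>.\<close>

lemma level_assignment:
  fixes w :: "nat set \<Rightarrow> real"
  assumes B: "\<And>v. finite (B v)" and disj: "\<And>u v. u \<noteq> v \<Longrightarrow> B u \<inter> B v = {}" and n: "0 < n"
  shows "\<lbrakk>\<forall>vs\<in>set vss. distinct vs; finite CC; \<And>C. C \<in> CC \<Longrightarrow> 0 \<le> w C\<rbrakk> \<Longrightarrow>
   \<exists>fs. (\<forall>i b. fs i b < n) \<and>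
    (\<Sum>C | C \<in> CC \<and> (\<forall>i<length vss. reach B (fs i) C (vss ! i) 0 < n). w C)
      \<le> (\<Sum>C\<in>CC. w C * (16 ^ (n * length vss) / 8 ^ length (filter (good B n C) (concat vss))))"
proof (induction vss arbitrary: CC)
  case Nil
  then show ?case using n by (intro exI[of _ "\<lambda>_ _. 0"]) auto
next
  case (Cons vs vss)
  let ?e = "\<lambda>C. 16 ^ (n * length vss) / 8 ^ length (filter (good B n C) (concat vss)) :: real"
  obtain f where f: "\<forall>b. f b < n"
    "(\<Sum>C | C \<in> CC \<and> reach B f C vs 0 < n. w C * ?e C)
      \<le> (\<Sum>C\<in>CC. w C * ?e C * (pot n 0 / 8 ^ length (filter (good B n C) vs)))"
    using level_assignment_path[of CC B n "\<lambda>C. w C * ?e C" vs "\<lambda>_. 0"] Cons.prems B disj n by auto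
  let ?CC = "{C \<in> CC. reach B f C vs 0 < n}"
  obtain fs where fs: "\<forall>i b. fs i b < n"
    "(\<Sum>C | C \<in> ?CC \<and> (\<forall>i<length vss. reach B (fs i) C (vss ! i) 0 < n). w C) \<le> (\<Sum>C\<in>?CC. w C * ?e C)"
    using Cons.IH[of ?CC] Cons.prems by auto
  define gs where "gs = (\<lambda>i. case i of 0 \<Rightarrow> f | Suc j \<Rightarrow> fs j)"
  have "{C. C \<in> CC \<and> (\<forall>i<length (vs # vss). reach B (gs i) C ((vs # vss) ! i) 0 < n)}
     = {C. C \<in> ?CC \<and> (\<forall>i<length vss. reach B (fs i) C (vss ! i) 0 < n)}"
    by (auto simp: gs_def less_Suc_eq_0_disj split: nat.splits)
  moreover have "w C * ?e C * (pot n 0 / 8 ^ length (filter (good B n C) vs))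
    = w C * (16 ^ (n * length (vs # vss)) / 8 ^ length (filter (good B n C) (concat (vs # vss))))" for C
    using n by (simp add: pot_def power_add mult_ac)
  ultimately show ?case using fs f by (intro exI[of _ gs]) (auto simp: gs_def split: nat.splits)
qed

text \<open>The greedy walk climbs at most once per node, so the bottlenecks it picks, one per
  level, lie at strictly successive nodes of the path. They form the route through the
  graph.\<close>

lemma reach_chain:
  assumes B: "\<And>v. B v = {b. b < M \<and> own b = v}"
  shows "reach B f C vs r = s \<Longrightarrow> \<exists>g.
    (\<forall>j. r \<le> j \<and> j < s \<longrightarrow> g j < M \<and> g j \<notin> C \<and> f (g j) = j \<and> own (g j) \<in> set vs) \<and>
    (\<forall>j. r \<le> j \<and> Suc j < s \<longrightarrow> prec vs (own (g j)) (own (g (Suc j))))"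
proof (induction vs arbitrary: r)
  case Nil
  then show ?case by auto
next
  case (Cons v vs)
  show ?case
  proof (cases "\<exists>b\<in>B v - C. f b = r")
    case False
    then have "reach B f C vs r = s" using Cons.prems by auto
    from Cons.IH[OF this] show ?thesis by (auto simp: prec_Cons)
  next
    case True
    then obtain b where b: "b \<in> B v" "b \<notin> C" "f b = r" by auto
    have "reach B f C vs (Suc r) = s" using Cons.prems True by auto
    from Cons.IH[OF this] obtain g where g:
      "\<forall>j. Suc r \<le> j \<and> j < s \<longrightarrow> g j < M \<and> g j \<notin> C \<and> f (g j) = j \<and> own (g j) \<in> set vs"
      "\<forall>j. Suc r \<le> j \<and> Suc j < s \<longrightarrow> prec vs (own (g j)) (own (g (Suc j)))" by blast
    have b': "b < M" "own b = v" using b B by auto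
    show ?thesis
    proof (intro exI[of _ "g(r := b)"] conjI allI impI)
      fix j assume j: "r \<le> j \<and> j < s"
      show "(g(r := b)) j < M" "(g(r := b)) j \<notin> C" "f ((g(r := b)) j) = j" "own ((g(r := b)) j) \<in> set (v # vs)"
        using j g(1) b b' by (cases "j = r"; auto)+
    next
      fix j assume j: "r \<le> j \<and> Suc j < s"
      show "prec (v # vs) (own ((g(r := b)) j)) (own ((g(r := b)) (Suc j)))"
        using j g b' by (cases "j = r") (auto simp: prec_Cons)
    qed
  qed
qed

section \<open>Multicuts and multicommodity flows\<close>

lemma outflow_add: "outflow E (\<lambda>e. f e + g e) v = outflow E f v + outflow E g v"
  by (simp add: outflow_def sum.distrib)

lemma inflow_add: "inflow E (\<lambda>e. f e + g e) v = inflow E f v + inflow E g v"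
  by (simp add: inflow_def sum.distrib)

lemma outflow_single:
  assumes "finite E" "e0 \<in> E"
  shows "outflow E (\<lambda>e. if e = e0 then 1 else 0) v = (if fst e0 = v then 1 else 0)"
  using assms by (simp add: outflow_def sum.delta)

lemma inflow_single:
  assumes "finite E" "e0 \<in> E"
  shows "inflow E (\<lambda>e. if e = e0 then 1 else 0) v = (if snd e0 = v then 1 else 0)"
  using assms by (simp add: inflow_def sum.delta)

text \<open>One unit is added per step of the walk; an edge may be repeated up to \<open>n\<close>
  times, hence the bound.\<close>

lemma walk_flow:
  assumes "finite E"
  shows "(s, t) \<in> E ^^ n \<Longrightarrow> \<exists>f. (\<forall>e. 0 \<le> f e \<and> f e \<le> real n) \<and>
    (\<forall>v. outflow E f v - inflow E f v = (if v = s then 1 else 0) - (if v = t then 1 else 0))"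
proof (induction n arbitrary: t)
  case 0
  then show ?case by (intro exI[of _ "\<lambda>_. 0"]) (auto simp: outflow_def inflow_def)
next
  case (Suc n)
  then obtain u where u: "(s, u) \<in> E ^^ n" "(u, t) \<in> E" by auto
  obtain f where f: "\<forall>e. 0 \<le> f e \<and> f e \<le> real n"
    "\<forall>v. outflow E f v - inflow E f v = (if v = s then 1 else 0) - (if v = u then 1 else 0)"
    using Suc.IH[OF u(1)] by blast
  let ?g = "\<lambda>e. f e + (if e = (u, t) then 1 else 0)"
  have "0 \<le> ?g e \<and> ?g e \<le> real (Suc n)" for e
    using f(1)[rule_format, of e] by auto
  moreover have "outflow E ?g v - inflow E ?g v = (if v = s then 1 else 0) - (if v = t then 1 else 0)" for v
    using f(2)[rule_format, of v]
    unfolding outflow_add inflow_add outflow_single[OF assms u(2)] inflow_single[OF assms u(2)] by auto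
  ultimately show ?case by (intro exI[of _ ?g]) simp
qed

text \<open>Summation by parts: conservation cancels every node except the two ends.\<close>

lemma flow_potential:
  assumes E: "finite E" and fl: "is_flow E s t f" and st: "s \<noteq> t"
  shows "(\<Sum>e\<in>E. f e * (\<phi> (snd e) - \<phi> (fst e))) = flow_value E s f * (\<phi> t - \<phi> s)"
proof -
  define W where "W = fst ` E \<union> snd ` E \<union> {s, t}"
  have W: "finite W" "fst ` E \<subseteq> W" "snd ` E \<subseteq> W" "s \<in> W" "t \<in> W" using E by (auto simp: W_def)
  have key: "(\<Sum>e\<in>E. f e * (\<psi> (snd e) - \<psi> (fst e)))
      = - flow_value E s f * \<psi> s + (inflow E f t - outflow E f t) * \<psi> t" for \<psi> :: "nat \<Rightarrow> real"
  proof -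
    have i: "(\<Sum>e\<in>E. f e * \<psi> (snd e)) = (\<Sum>v\<in>W. inflow E f v * \<psi> v)"
      unfolding inflow_def sum_distrib_right
      by (subst sum.group[OF E W(1) W(3), symmetric]) (auto intro!: sum.cong)
    have o: "(\<Sum>e\<in>E. f e * \<psi> (fst e)) = (\<Sum>v\<in>W. outflow E f v * \<psi> v)"
      unfolding outflow_def sum_distrib_right
      by (subst sum.group[OF E W(1) W(2), symmetric]) (auto intro!: sum.cong)
    have "(\<Sum>e\<in>E. f e * (\<psi> (snd e) - \<psi> (fst e))) = (\<Sum>v\<in>W. (inflow E f v - outflow E f v) * \<psi> v)"
      by (simp add: right_diff_distrib left_diff_distrib sum_subtractf i o)
    also have "\<dots> = (\<Sum>v\<in>{s, t}. (inflow E f v - outflow E f v) * \<psi> v)"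
      using fl W by (intro sum.mono_neutral_right) (auto simp: is_flow_def)
    finally show ?thesis using st by (simp add: flow_value_def)
  qed
  \<comment> \<open>A constant potential makes the left side of \<open>key\<close> zero, so what
    leaves \<open>s\<close> arrives at \<open>t\<close>.\<close>
  have "inflow E f t - outflow E f t = flow_value E s f" using key[of "\<lambda>_. 1"] by simp
  then show ?thesis using key[of \<phi>] by (simp add: algebra_simps)
qed

text \<open>Weak duality: \<open>l\<close> is a length function on the edges, and the potential
  \<open>\<phi> q\<close> certifies that the ends of \<open>q\<close> have distance at least
  1.\<close>

lemma MMFlow_le:
  assumes E: "finite E" and P: "finite P" "\<And>q. q \<in> P \<Longrightarrow> fst q \<noteq> snd q"
    and phi: "\<And>q e. q \<in> P \<Longrightarrow> e \<in> E \<Longrightarrow> \<phi> q (snd e) - \<phi> q (fst e) \<le> l e"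
    and one: "\<And>q. q \<in> P \<Longrightarrow> \<phi> q (snd q) - \<phi> q (fst q) = 1"
    and l: "\<And>e. e \<in> E \<Longrightarrow> 0 \<le> l e"
  shows "MMFlow E P \<le> (\<Sum>e\<in>E. l e)"
  unfolding MMFlow_def
proof (rule cSup_least)
  show "{(\<Sum>q\<in>P. flow_value E (fst q) (F q)) | F. is_mcflow E P F} \<noteq> {}"
    by (auto simp: is_mcflow_def is_flow_def inflow_def outflow_def intro!: exI[of _ "\<lambda>_ _. 0"])
  fix x assume "x \<in> {(\<Sum>q\<in>P. flow_value E (fst q) (F q)) | F. is_mcflow E P F}"
  then obtain F where F: "is_mcflow E P F" and x: "x = (\<Sum>q\<in>P. flow_value E (fst q) (F q))" by auto
  have "flow_value E (fst q) (F q) \<le> (\<Sum>e\<in>E. F q e * l e)" if q: "q \<in> P" for q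
  proof -
    have fl: "is_flow E (fst q) (snd q) (F q)" using F q by (force simp: is_mcflow_def)
    have "flow_value E (fst q) (F q) = (\<Sum>e\<in>E. F q e * (\<phi> q (snd e) - \<phi> q (fst e)))"
      using flow_potential[OF E fl P(2)[OF q], of "\<phi> q"] one[OF q] by simp
    also have "\<dots> \<le> (\<Sum>e\<in>E. F q e * l e)"
      using fl phi[OF q] by (intro sum_mono mult_left_mono) (auto simp: is_flow_def)
    finally show ?thesis .
  qed
  then have "x \<le> (\<Sum>q\<in>P. \<Sum>e\<in>E. F q e * l e)" unfolding x by (rule sum_mono)
  also have "\<dots> = (\<Sum>e\<in>E. (\<Sum>q\<in>P. F q e) * l e)" by (subst sum.swap) (simp add: sum_distrib_right)
  also have "\<dots> \<le> (\<Sum>e\<in>E. 1 * l e)"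
    using F l by (intro sum_mono mult_right_mono) (auto simp: is_mcflow_def)
  finally show "x \<le> (\<Sum>e\<in>E. l e)" by simp
qed

text \<open>The supremum of reals needs a bound: the value of a commodity is at most its total over
  all edges, and the capacities sum to \<open>card E\<close>.\<close>

lemma mcflow_value_le_MMFlow:
  assumes E: "finite E" and P: "finite P" and F: "is_mcflow E P F"
  shows "(\<Sum>q\<in>P. flow_value E (fst q) (F q)) \<le> MMFlow E P"
proof -
  have "(\<Sum>q\<in>P. flow_value E (fst q) (F q)) \<le> real (card E)" if F: "is_mcflow E P F" for F
  proof -
    have "flow_value E (fst q) (F q) \<le> (\<Sum>e\<in>E. F q e)" if q: "q \<in> P" for q
    proof -
      have nn: "\<And>e. e \<in> E \<Longrightarrow> 0 \<le> F q e" using F q by (force simp: is_mcflow_def is_flow_def)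
      then have "0 \<le> inflow E (F q) (fst q)" unfolding inflow_def by (auto intro!: sum_nonneg)
      moreover have "outflow E (F q) (fst q) \<le> (\<Sum>e\<in>E. F q e)"
        unfolding outflow_def using nn E by (intro sum_mono2) auto
      ultimately show ?thesis by (simp add: flow_value_def)
    qed
    then have "(\<Sum>q\<in>P. flow_value E (fst q) (F q)) \<le> (\<Sum>q\<in>P. \<Sum>e\<in>E. F q e)" by (rule sum_mono)
    also have "\<dots> = (\<Sum>e\<in>E. \<Sum>q\<in>P. F q e)" by (rule sum.swap)
    also have "\<dots> \<le> (\<Sum>e\<in>E. 1)" using F by (intro sum_mono) (auto simp: is_mcflow_def)
    finally show ?thesis by simp
  qed
  then show ?thesis unfolding MMFlow_def using F
    by (intro cSup_upper) (auto intro!: bdd_aboveI[of _ "real (card E)"])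
qed

lemma MCut_le: "is_multicut E P C \<Longrightarrow> MCut E P \<le> card C"
  unfolding MCut_def by (rule cInf_lower) auto

lemma MCut_attained:
  assumes "\<And>q. q \<in> P \<Longrightarrow> fst q \<noteq> snd q"
  obtains C where "is_multicut E P C" "MCut E P = card C"
proof -
  have "is_multicut E P E" using assms by (fastforce simp: is_multicut_def)
  then have "{card C | C. is_multicut E P C} \<noteq> {}" by auto
  then have "Inf {card C | C. is_multicut E P C} \<in> {card C | C. is_multicut E P C}" by (rule Inf_nat_def1)
  then show ?thesis using that by (auto simp: MCut_def)
qed

text \<open>Some finite ratio must exist, since otherwise the \<open>LEAST\<close> in \<open>MCG\<close> is a junk value.\<close>

lemma MCut_le_power4_MMFlow:
  assumes G: "digraph V E" "card V = N" "demands V P"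
  shows "real (MCut E P) \<le> real (N ^ 4) * MMFlow E P"
proof -
  have E: "finite E" and P: "finite P"
    using G unfolding digraph_def demands_def by (meson finite_SigmaI finite_subset)+
  have ne: "fst q \<noteq> snd q" if "q \<in> P" for q using G(3) that by (force simp: demands_def)
  have "card E \<le> card (V \<times> V)" using G by (intro card_mono) (auto simp: digraph_def)
  then have cE: "card E \<le> N ^ 2" using G(2) by (simp add: card_cartesian_product power2_eq_square)
  show ?thesis
  proof (cases "is_multicut E P {}")
    case True
    have "is_mcflow E P (\<lambda>_ _. 0)" by (auto simp: is_mcflow_def is_flow_def inflow_def outflow_def)
    from mcflow_value_le_MMFlow[OF E P this] have "0 \<le> MMFlow E P"
      by (simp add: flow_value_def inflow_def outflow_def)
    then show ?thesis using MCut_le[OF True] by simp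
  next
    case False
    then obtain s t where st: "(s, t) \<in> P" "(s, t) \<in> E\<^sup>*" by (auto simp: is_multicut_def)
    then obtain n where n: "n \<le> card E" "(s, t) \<in> E ^^ n"
      using rtrancl_finite_eq_relpow[OF E] by auto
    have neq: "s \<noteq> t" using ne[OF st(1)] by simp
    have npos: "0 < card E" using n neq by (cases "card E") auto
    have Npos: "0 < real (N ^ 2)" using npos cE by (cases "N = 0") auto
    obtain f where f: "\<forall>e. 0 \<le> f e \<and> f e \<le> real n"
      "\<forall>v. outflow E f v - inflow E f v = (if v = s then 1 else 0) - (if v = t then 1 else 0)"
      using walk_flow[OF E n(2)] by blast
    \<comment> \<open>The walk has at most \<open>N ^ 2\<close> steps, so its flow scaled by
      \<open>1 / N ^ 2\<close> respects the capacities. With at most \<open>N ^ 2\<close> edges to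
      cut, the ratio is at most \<open>N ^ 4\<close>.\<close>
    define F where "F = (\<lambda>q e. if q = (s, t) then f e / real (N ^ 2) else 0)"
    have out: "outflow E (\<lambda>e. f e / real (N ^ 2)) v = outflow E f v / real (N ^ 2)"
      and inn: "inflow E (\<lambda>e. f e / real (N ^ 2)) v = inflow E f v / real (N ^ 2)" for v
      by (simp_all add: outflow_def inflow_def sum_divide_distrib)
    have F1: "F (s, t) = (\<lambda>e. f e / real (N ^ 2))" and F0: "q \<noteq> (s, t) \<Longrightarrow> F q = (\<lambda>_. 0)" for q
      by (auto simp: F_def)
    have "is_mcflow E P F" unfolding is_mcflow_def
    proof (intro conjI ballI)
      fix q assume "q \<in> P"
      show "case q of (s', t') \<Rightarrow> is_flow E s' t' (F (s', t'))"
      proof (cases "q = (s, t)")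
        case True
        have "inflow E f v = outflow E f v" if "v \<noteq> s" "v \<noteq> t" for v
          using f(2)[rule_format, of v] that by simp
        moreover have "0 \<le> f e / real (N ^ 2)" for e using f(1)[rule_format, of e] by simp
        ultimately show ?thesis using True
          by (simp add: F1 is_flow_def out inn del: of_nat_power)
      next
        case False
        then obtain s' t' where q: "q = (s', t')" "(s', t') \<noteq> (s, t)" by (cases q) auto
        show ?thesis unfolding q(1) prod.case F0[OF q(2)]
          by (simp add: is_flow_def inflow_def outflow_def)
      qed
    next
      fix e assume "e \<in> E"
      have "(\<Sum>q\<in>P. F q e) = f e / real (N ^ 2)"
        using P st(1) by (simp add: F_def sum.delta)
      also have "\<dots> \<le> 1" using f(1)[rule_format, of e] n(1) cE Npos
        by (simp add: divide_le_eq del: of_nat_power)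
      finally show "(\<Sum>q\<in>P. F q e) \<le> 1" .
    qed
    from mcflow_value_le_MMFlow[OF E P this]
    have "(\<Sum>q\<in>P. flow_value E (fst q) (F q)) \<le> MMFlow E P" .
    moreover have "(\<Sum>q\<in>P. flow_value E (fst q) (F q)) = (\<Sum>q\<in>P. if q = (s, t) then 1 / real (N ^ 2) else 0)"
    proof (rule sum.cong[OF refl])
      fix q assume "q \<in> P"
      show "flow_value E (fst q) (F q) = (if q = (s, t) then 1 / real (N ^ 2) else 0)"
      proof (cases "q = (s, t)")
        case True
        have "outflow E f s - inflow E f s = 1" using f(2) neq by auto
        then show ?thesis using True by (simp add: F1 flow_value_def out inn diff_divide_distrib[symmetric] del: of_nat_power)
      qed (simp add: F0 flow_value_def outflow_def inflow_def)
    qed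
    ultimately have fl: "1 / real (N ^ 2) \<le> MMFlow E P" using P st(1) by (simp add: sum.delta)
    have "is_multicut E P E" using ne by (fastforce simp: is_multicut_def)
    then have "real (MCut E P) \<le> real (N ^ 2)" using MCut_le[of E P E] cE by (simp del: of_nat_power)
    also have "\<dots> = real (N ^ 4) * (1 / real (N ^ 2))" using Npos by (simp add: power_numeral_reduce)
    also have "\<dots> \<le> real (N ^ 4) * MMFlow E P" using fl by (intro mult_left_mono) auto
    finally show ?thesis .
  qed
qed

lemma MCG_property:
  assumes "digraph V E" "card V = N" "demands V P"
  shows "real (MCut E P) \<le> real (MCG N) * MMFlow E P"
proof -
  have "\<forall>V E P. digraph V E \<and> card V = N \<and> demands V P \<longrightarrow> real (MCut E P) \<le> real (MCG N) * MMFlow E P"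
    unfolding MCG_def by (rule LeastI[of _ "N ^ 4"]) (use MCut_le_power4_MMFlow in blast)
  then show ?thesis using assms by blast
qed

text \<open>Union bound over at most \<open>2 ^ M\<close> sets \<open>C\<close>: each keeps enough
  good occurrences to get weight at most \<open>1 / 2 ^ (M + 1)\<close>, so fewer than one set
  defeats all paths. A path may use all bottlenecks of its nodes, also those stemming from other
  paths.\<close>

lemma levels_exist:
  fixes Ps :: "nat list list"
  defines "W \<equiv> concat Ps" and "M \<equiv> length (concat Ps)"
  defines "B \<equiv> (\<lambda>v. {b. b < length (concat Ps) \<and> concat Ps ! b = v})"
  assumes dist: "\<forall>vs\<in>set Ps. distinct vs" and l: "0 < l" and M: "0 < M"
    and big: "32 * l * card (set W) \<le> M" "32 * l * length Ps \<le> M"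
  obtains lev where "\<And>i b. lev i b < l"
    "\<And>C. C \<subseteq> {..<M} \<Longrightarrow> 8 * card C \<le> M \<Longrightarrow> \<exists>i<length Ps. l \<le> reach B (lev i) C (Ps ! i) 0"
proof -
  define CC where "CC = {C. C \<subseteq> {..<M} \<and> 8 * card C \<le> M}"
  have CC: "finite CC" "card CC \<le> 2 ^ M"
  proof -
    have "CC \<subseteq> Pow {..<M}" by (auto simp: CC_def)
    then show "finite CC" "card CC \<le> 2 ^ M"
      using finite_subset card_mono[of "Pow {..<M}" CC] by (auto simp: card_Pow)
  qed
  have B: "finite (B v)" "u \<noteq> v \<Longrightarrow> B u \<inter> B v = {}" for u v by (auto simp: B_def)
  define p where "p = length Ps"
  \<comment> \<open>At most \<open>M / 8\<close> occurrences lie in \<open>C\<close>, and the bad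
    nodes keep fewer than \<open>4 * l\<close> survivors each, again at most \<open>M / 8\<close> in
    total. So at least three quarters are good.\<close>
  have G: "4 * length (filter (good B l C) W) \<ge> 3 * M" if C: "C \<in> CC" for C
  proof -
    let ?bad = "{b. b < M \<and> \<not> good B l C (W ! b)}"
    have finC: "finite C" using C finite_subset by (auto simp: CC_def)
    have "?bad \<subseteq> C \<union> (\<Union>v\<in>{v \<in> set W. \<not> good B l C v}. B v - C)"
    proof
      fix b assume b: "b \<in> ?bad"
      then have "W ! b \<in> set W" unfolding M_def W_def by (intro nth_mem) auto
      moreover have "b \<in> B (W ! b)" using b by (auto simp: M_def W_def B_def)
      ultimately show "b \<in> C \<union> (\<Union>v\<in>{v \<in> set W. \<not> good B l C v}. B v - C)" using b by blast
    qed
    then have "card ?bad \<le> card (C \<union> (\<Union>v\<in>{v \<in> set W. \<not> good B l C v}. B v - C))"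
      using finC B by (intro card_mono) auto
    also have "\<dots> \<le> card C + card (\<Union>v\<in>{v \<in> set W. \<not> good B l C v}. B v - C)" by (rule card_Un_le)
    also have "card (\<Union>v\<in>{v \<in> set W. \<not> good B l C v}. B v - C) \<le> (\<Sum>v\<in>{v \<in> set W. \<not> good B l C v}. card (B v - C))"
      by (rule card_UN_le) auto
    also have "\<dots> \<le> (\<Sum>v\<in>{v \<in> set W. \<not> good B l C v}. 4 * l)"
      by (rule sum_mono) (auto simp: good_def)
    also have "\<dots> \<le> card (set W) * (4 * l)" by (simp add: card_mono)
    finally have bad: "card ?bad \<le> card C + card (set W) * (4 * l)" by simp
    have "8 * card C \<le> M" using C by (simp add: CC_def)
    moreover have "32 * (card (set W) * l) \<le> M" using big(1) by (simp add: mult_ac)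
    ultimately have "4 * card ?bad \<le> M" using bad by linarith
    moreover have "card {b. b < M \<and> good B l C (W ! b)} + card ?bad = M"
    proof -
      have "card {b. b < M \<and> good B l C (W ! b)} + card ?bad = card ({b. b < M \<and> good B l C (W ! b)} \<union> ?bad)"
        by (rule card_Un_disjoint[symmetric]) auto
      also have "{b. b < M \<and> good B l C (W ! b)} \<union> ?bad = {..<M}" by auto
      finally show ?thesis by simp
    qed
    moreover have "length (filter (good B l C) W) = card {b. b < M \<and> good B l C (W ! b)}"
      by (simp add: length_filter_conv_card M_def W_def)
    ultimately show ?thesis by linarith
  qed
  obtain fs where fs: "\<forall>i b. fs i b < l"
    "(\<Sum>C | C \<in> CC \<and> (\<forall>i<length Ps. reach B (fs i) C (Ps ! i) 0 < l). 1 :: real)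
      \<le> (\<Sum>C\<in>CC. 1 * (16 ^ (l * length Ps) / 8 ^ length (filter (good B l C) (concat Ps))))"
    using level_assignment[of B l Ps CC "\<lambda>_. 1"] B dist CC l by auto
  have "1 * (16 ^ (l * length Ps) / 8 ^ length (filter (good B l C) (concat Ps))) \<le> (1 / 2 ^ (M + 1) :: real)"
    if C: "C \<in> CC" for C
  proof -
    let ?G = "length (filter (good B l C) (concat Ps))"
    \<comment> \<open>Exponents of two: the initial potential takes at most \<open>M / 8\<close> and
      the number of sets \<open>M\<close>, with 1 to spare, while the good occurrences supply at
      least \<open>9 * M / 4\<close>.\<close>
    have "4 * (l * p) + (M + 1) \<le> 3 * ?G"
    proof -
      have "32 * (l * p) \<le> M" using big(2) by (simp add: p_def mult_ac)
      then show ?thesis using G[OF C] M unfolding W_def by linarith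
    qed
    then have "(2::real) ^ (4 * (l * p) + (M + 1)) \<le> 2 ^ (3 * ?G)" by (intro power_increasing) auto
    moreover have "(2::real) ^ (4 * (l * p) + (M + 1)) = 16 ^ (l * p) * 2 ^ (M + 1)"
      unfolding power_add power_mult by simp
    moreover have "(2::real) ^ (3 * ?G) = 8 ^ ?G" unfolding power_mult by simp
    ultimately have "16 ^ (l * p) * 2 ^ (M + 1) \<le> (8::real) ^ ?G" by simp
    then have "16 ^ (l * p) / (8::real) ^ ?G \<le> 1 / 2 ^ (M + 1)" by (simp add: divide_simps)
    then show ?thesis unfolding p_def by simp
  qed
  then have "(\<Sum>C\<in>CC. 1 * (16 ^ (l * length Ps) / 8 ^ length (filter (good B l C) (concat Ps))))
    \<le> real (card CC) * (1 / 2 ^ (M + 1))" by (rule sum_bounded_above)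
  also have "\<dots> \<le> 2 ^ M * (1 / 2 ^ (M + 1))"
    using CC(2) of_nat_le_iff[of "card CC" "2 ^ M", where 'a = real] by (intro mult_right_mono) auto
  also have "\<dots> < 1" by simp
  finally have "real (card {C. C \<in> CC \<and> (\<forall>i<length Ps. reach B (fs i) C (Ps ! i) 0 < l)}) < 1" using fs(2) by simp
  then have "{C. C \<in> CC \<and> (\<forall>i<length Ps. reach B (fs i) C (Ps ! i) 0 < l)} = {}"
    using CC by simp
  then have "\<exists>i<length Ps. l \<le> reach B (fs i) C (Ps ! i) 0" if "C \<subseteq> {..<M}" "8 * card C \<le> M" for C
    using that unfolding CC_def by (auto simp: not_less)
  then show ?thesis using that[of fs] fs(1) by blast
qed

section \<open>The gap instance of an acyclic system\<close>

locale acyclic_system =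
  fixes Ps :: "nat list list" and rank :: "nat \<Rightarrow> nat"
  assumes bridgeless: "bridgeless Ps"
    and rank: "i < length Ps \<Longrightarrow> prec (Ps ! i) x y \<Longrightarrow> rank x < rank y"
begin

text \<open>A second path ordering the same pair would give a 2-bridge.\<close>

lemma unique_path:
  assumes "i < length Ps" "k < length Ps" "prec (Ps ! i) x y" "prec (Ps ! k) x y"
  shows "i = k"
proof (rule ccontr)
  assume "i \<noteq> k"
  then show False
    using bridgeless_no_rainbow_walk[OF bridgeless assms(1), of "\<lambda>_. k" 1 "\<lambda>j. if j = 0 then x else y"]
      assms rank[OF assms(1,3)] by (auto simp: inj_on_def)
qed

lemma prec_if_rank_less:
  assumes "i < length Ps" "x \<in> set (Ps ! i)" "y \<in> set (Ps ! i)" "rank x < rank y"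
  shows "prec (Ps ! i) x y"
  using prec_total[OF assms(2,3)] rank[OF assms(1), of y x] assms(4) by auto

text \<open>The walk leaves path \<open>i\<close> at \<open>vs 0\<close> and returns only at
  \<open>vs m\<close>, so path \<open>i\<close> is a chord that no hop uses. If the hops use
  distinct paths, bridgelessness excludes this. Otherwise a path used at hops \<open>a < c\<close>
  leads, by the ranks, directly from \<open>vs a\<close> to \<open>vs (Suc c)\<close>, and the walk
  gets shorter.\<close>

lemma no_excursion_walk:
  "\<lbrakk>i < length Ps; 2 \<le> m; vs 0 \<in> set (Ps ! i); vs m \<in> set (Ps ! i);
    \<And>j. 0 < j \<Longrightarrow> j < m \<Longrightarrow> vs j \<notin> set (Ps ! i);
    \<And>j. j < m \<Longrightarrow> ks j < length Ps \<and> prec (Ps ! ks j) (vs j) (vs (Suc j))\<rbrakk> \<Longrightarrow> False"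
proof (induction m arbitrary: vs ks rule: less_induct)
  case (less m)
  have mono: "rank (vs a) < rank (vs c)" if "a < c" "c \<le> m" for a c
    using that
  proof (induction c)
    case (Suc c)
    have "rank (vs c) < rank (vs (Suc c))" using less.prems(6)[of c] Suc.prems rank by auto
    then show ?case using Suc by (cases "a = c") auto
  qed simp
  have chord: "prec (Ps ! i) (vs 0) (vs m)"
    using prec_if_rank_less[OF less.prems(1,3,4)] mono[of 0 m] less.prems(2) by simp
  have ki: "ks j \<noteq> i" if "j < m" for j
  proof
    assume "ks j = i"
    then have "vs j \<in> set (Ps ! i)" "vs (Suc j) \<in> set (Ps ! i)"
      using less.prems(6)[OF that] prec_in_set by auto
    then show False using less.prems(5)[of j] less.prems(5)[of "Suc j"] less.prems(2) that
      by (cases "j = 0") auto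
  qed
  show False
  proof (cases "inj_on ks {..<m}")
    case True
    have "vs 0 \<noteq> vs m" using mono[of 0 m] less.prems(2) by auto
    then show False
      using bridgeless_no_rainbow_walk[OF bridgeless less.prems(1) True _ chord] less.prems(6) ki by blast
  next
    case False
    then obtain a c where ac: "a < c" "c < m" "ks a = ks c"
      unfolding inj_on_def by (metis lessThan_iff linorder_neqE_nat)
    define d where "d = c - a"
    have d: "0 < d" "a + d = c" using ac by (auto simp: d_def)
    let ?k = "ks a"
    have k: "?k < length Ps" "vs a \<in> set (Ps ! ?k)" "vs (Suc c) \<in> set (Ps ! ?k)"
      using less.prems(6)[of a] less.prems(6)[of c] ac prec_in_set by auto
    have hop: "prec (Ps ! ?k) (vs a) (vs (Suc c))"
      using prec_if_rank_less[OF k] mono[of a "Suc c"] ac by auto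
    define ws where "ws = (\<lambda>j. if j \<le> a then vs j else vs (j + d))"
    define ls where "ls = (\<lambda>j. if j \<le> a then ks j else ks (j + d))"
    have hops: "ls j < length Ps \<and> prec (Ps ! ls j) (ws j) (ws (Suc j))" if "j < m - d" for j
    proof -
      consider "j < a" | "j = a" | "a < j" by linarith
      then show ?thesis
      proof cases
        case 1 then show ?thesis using less.prems(6)[of j] ac by (auto simp: ls_def ws_def)
      next
        case 2 then show ?thesis using hop k d by (auto simp: ls_def ws_def)
      next
        case 3 then show ?thesis using less.prems(6)[of "j + d"] that by (auto simp: ls_def ws_def)
      qed
    qed
    have md: "m - d < m" "ws (m - d) = vs m" "ws 0 = vs 0" using d ac by (auto simp: ws_def)
    have int: "ws j \<notin> set (Ps ! i)" if "0 < j" "j < m - d" for j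
      using less.prems(5)[of j] less.prems(5)[of "j + d"] that by (auto simp: ws_def)
    show False
    proof (cases "2 \<le> m - d")
      case True
      then show False using less.IH[OF md(1) less.prems(1) True, of ws ls] md less.prems(3,4) int hops by auto
    next
      case False
      \<comment> \<open>Here the shortcut replaces the entire walk by one hop on a path other than
        \<open>i\<close>, against \<open>unique_path\<close>.\<close>
      then have "a = 0" "Suc c = m" using d ac by auto
      then show False using unique_path[OF less.prems(1) k(1) chord] hop ki[of a] ac by auto
    qed
  qed
qed

definition step :: "(nat \<times> nat) set" where
  "step = {(a, b). \<exists>k<length Ps. prec (Ps ! k) a b}"

text \<open>The stretch from the last node on path \<open>i\<close> before \<open>w\<close> to the
  return at \<open>y\<close> would be an excursion.\<close>

lemma paths_convex:
  assumes i: "i < length Ps" and x: "x \<in> set (Ps ! i)" and xw: "(x, w) \<in> step\<^sup>*"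
    and wy: "(w, y) \<in> step" and y: "y \<in> set (Ps ! i)"
  shows "w \<in> set (Ps ! i)"
proof (rule ccontr)
  assume w: "w \<notin> set (Ps ! i)"
  obtain n where "(x, w) \<in> step ^^ n" using xw rtrancl_imp_relpow by blast
  then obtain f where f: "f 0 = x" "f n = w" "\<And>j. j < n \<Longrightarrow> (f j, f (Suc j)) \<in> step"
    unfolding relpow_fun_conv by blast
  define g where "g = f(Suc n := y)"
  have g: "(g j, g (Suc j)) \<in> step" if "j < Suc n" for j
    using that f wy by (cases "j = n") (auto simp: g_def)
  define S where "S = {j. j \<le> n \<and> g j \<in> set (Ps ! i)}"
  have S: "finite S" "0 \<in> S" using f x by (auto simp: S_def g_def)
  define a where "a = Max S"
  have "S \<noteq> {}" using S(2) by blast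
  then have a1: "a \<in> S" unfolding a_def by (rule Max_in[OF S(1)])
  have a2: "j \<le> a" if "j \<in> S" for j unfolding a_def by (rule Max_ge[OF S(1) that])
  have "a \<noteq> n" using a1 w f(2) by (auto simp: S_def g_def)
  then have an: "a < n" using a1 by (auto simp: S_def)
  define ks where "ks = (\<lambda>j. SOME k. k < length Ps \<and> prec (Ps ! k) (g (a + j)) (g (Suc (a + j))))"
  have ks: "ks j < length Ps \<and> prec (Ps ! ks j) (g (a + j)) (g (Suc (a + j)))" if "j < Suc n - a" for j
    proof -
    have "(g (a + j), g (Suc (a + j))) \<in> step" using g[of "a + j"] that by simp
    then have "\<exists>k. k < length Ps \<and> prec (Ps ! k) (g (a + j)) (g (Suc (a + j)))" by (auto simp: step_def)
    then show ?thesis unfolding ks_def by (rule someI_ex)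
  qed
  show False
  proof (rule no_excursion_walk[OF i, of "Suc n - a" "\<lambda>j. g (a + j)" ks])
    show "2 \<le> Suc n - a" using an by auto
    show "g (a + 0) \<in> set (Ps ! i)" using a1 by (auto simp: S_def)
    show "g (a + (Suc n - a)) \<in> set (Ps ! i)" using an y by (simp add: g_def)
    show "g (a + j) \<notin> set (Ps ! i)" if "0 < j" "j < Suc n - a" for j
    proof -
      have "a + j \<le> n" using that an by linarith
      then show ?thesis using a2[of "a + j"] that(1) by (auto simp: S_def)
    qed
    show "ks j < length Ps \<and> prec (Ps ! ks j) (g (a + j)) (g (a + Suc j))" if "j < Suc n - a" for j
      using ks[OF that] by simp
  qed
qed

end

section \<open>The graph of bottlenecks with its flow and cut bounds\<close>

locale gap_instance = acyclic_system +
  fixes lev :: "nat \<Rightarrow> nat \<Rightarrow> nat" and l :: nat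
  assumes lev_less: "lev i b < l"
begin

abbreviation "M \<equiv> length (concat Ps)"
abbreviation "own b \<equiv> concat Ps ! b"
abbreviation "p \<equiv> length Ps"

text \<open>
  Bottleneck \<open>b < M\<close> is the edge from \<open>b\<close> to \<open>M + b\<close>; the source and the sink of path \<open>i\<close> are
  \<open>2 * M + i\<close> and \<open>2 * M + p + i\<close>.
\<close>

definition edges :: "(nat \<times> nat) set" where
  "edges = {(b, M + b) | b. b < M}
    \<union> {(M + b, b') | b b'. b < M \<and> b' < M \<and>
        (\<exists>i<p. prec (Ps ! i) (own b) (own b') \<and> lev i b' = Suc (lev i b))}
    \<union> {(2 * M + i, b) | i b. i < p \<and> b < M \<and> own b \<in> set (Ps ! i) \<and> lev i b = 0}
    \<union> {(M + b, 2 * M + p + i) | i b. i < p \<and> b < M \<and> own b \<in> set (Ps ! i) \<and> Suc (lev i b) = l}"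

definition pairs :: "(nat \<times> nat) set" where
  "pairs = {(2 * M + i, 2 * M + p + i) | i. i < p}"

lemma edges_cases:
  assumes "e \<in> edges"
  obtains (bottleneck) b where "e = (b, M + b)" "b < M"
  | (hop) b b' i where "e = (M + b, b')" "b < M" "b' < M" "i < p" "prec (Ps ! i) (own b) (own b')"
      "lev i b' = Suc (lev i b)"
  | (source) i b where "e = (2 * M + i, b)" "i < p" "b < M" "own b \<in> set (Ps ! i)" "lev i b = 0"
  | (sink) i b where "e = (M + b, 2 * M + p + i)" "i < p" "b < M" "own b \<in> set (Ps ! i)" "Suc (lev i b) = l"
  using assms unfolding edges_def by blast

lemma edges_subset: "edges \<subseteq> {..<2 * M + 2 * p} \<times> {..<2 * M + 2 * p}"
proof
  fix e assume "e \<in> edges"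
  then show "e \<in> {..<2 * M + 2 * p} \<times> {..<2 * M + 2 * p}" by (cases rule: edges_cases) auto
qed

lemma finite_edges: "finite edges"
  by (rule finite_subset[OF edges_subset]) auto

lemma pairs_image: "pairs = (\<lambda>i. (2 * M + i, 2 * M + p + i)) ` {..<p}"
  by (auto simp: pairs_def)

text \<open>The dual potential of pair \<open>i\<close>; \<open>k\<close> is 0 at the tail and 1 at
  the head of a bottleneck. Off the path, nodes reachable from it get the minimum 0, since convexity
  forbids a return, and all others the maximum \<open>l\<close>, so that no hop out of them raises
  the potential.\<close>

definition place_pot :: "nat \<Rightarrow> nat \<Rightarrow> nat \<Rightarrow> real" where
  "place_pot i k b = (if own b \<in> set (Ps ! i) then real (lev i b + k)
     else if \<exists>x\<in>set (Ps ! i). (x, own b) \<in> step\<^sup>* then 0 else real l)"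

text \<open>Foreign sources carry \<open>l\<close> and foreign sinks 0, so their edges never raise
  the potential.\<close>

definition vertex_pot :: "nat \<Rightarrow> nat \<Rightarrow> real" where
  "vertex_pot i x = (if x < M then place_pot i 0 x else if x < 2 * M then place_pot i 1 (x - M)
     else if x < 2 * M + p then (if x = 2 * M + i then 0 else real l)
     else if x = 2 * M + p + i then real l else 0)"

lemma place_pot_bounds: "0 \<le> place_pot i k b" "k \<le> 1 \<Longrightarrow> place_pot i k b \<le> real l"
  using lev_less[of i b] by (auto simp: place_pot_def)

text \<open>A hop with both ends on path \<open>i\<close> belongs to path \<open>i\<close> by
  \<open>unique_path\<close>, and its level increase is the unit already gained on the bottleneck.
  Any other hop ends at potential 0 or starts at the maximum.\<close>

lemma place_pot_hop:
  assumes i: "i < p" and k: "k < p" "prec (Ps ! k) (own b) (own b')" "lev k b' = Suc (lev k b)"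
  shows "place_pot i 0 b' \<le> place_pot i 1 b"
proof -
  have st: "(own b, own b') \<in> step" using k by (auto simp: step_def)
  consider (on) "own b \<in> set (Ps ! i)"
    | (off) x where "own b \<notin> set (Ps ! i)" "x \<in> set (Ps ! i)" "(x, own b) \<in> step\<^sup>*"
    | (unreached) "own b \<notin> set (Ps ! i)" "\<not> (\<exists>x\<in>set (Ps ! i). (x, own b) \<in> step\<^sup>*)" by blast
  then show ?thesis
  proof cases
    case on
    show ?thesis
    proof (cases "own b' \<in> set (Ps ! i)")
      case True
      have "prec (Ps ! i) (own b) (own b')" using prec_if_rank_less[OF i on True] rank[OF k(1,2)] by simp
      then have "k = i" using unique_path[OF k(1) i k(2)] by simp
      then show ?thesis using on True k(3) by (simp add: place_pot_def)
    next
      case False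
      then have "place_pot i 0 b' = 0" using on st by (auto simp: place_pot_def)
      then show ?thesis using place_pot_bounds(1) by simp
    qed
  next
    case off
    have "own b' \<notin> set (Ps ! i)" using paths_convex[OF i off(2,3) st] off(1) by blast
    moreover have "(x, own b') \<in> step\<^sup>*" using off(3) st by simp
    ultimately have "place_pot i 0 b' = 0" using off(2) by (auto simp: place_pot_def)
    then show ?thesis using place_pot_bounds(1) by simp
  next
    case unreached
    then show ?thesis using place_pot_bounds(2)[of 0] by (simp add: place_pot_def)
  qed
qed

lemma vertex_pot_edge:
  assumes i: "i < p" and e: "e \<in> edges"
  shows "vertex_pot i (snd e) - vertex_pot i (fst e) \<le> (if fst e < M then 1 else 0)"
  using e
proof (cases rule: edges_cases)
  case (bottleneck b)
  then show ?thesis by (auto simp: vertex_pot_def place_pot_def)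
next
  case (hop b b' k)
  then show ?thesis using place_pot_hop[OF i hop(4,5,6)] by (simp add: vertex_pot_def)
next
  case (source k b)
  then show ?thesis using place_pot_bounds(2)[of 0 i b] by (auto simp: vertex_pot_def place_pot_def)
next
  case (sink k b)
  then show ?thesis using place_pot_bounds(1)[of i 1 b] by (auto simp: vertex_pot_def place_pot_def)
qed

text \<open>Duality with length \<open>1 / l\<close> on each of the \<open>M\<close> bottlenecks and
  0 elsewhere.\<close>

lemma MMFlow_upper: "MMFlow edges pairs \<le> real M / real l"
proof -
  have l: "0 < l" using lev_less[of 0 0] by simp
  define lf where "lf = (\<lambda>e::nat \<times> nat. if fst e < M then 1 / real l else 0)"
  have "MMFlow edges pairs \<le> (\<Sum>e\<in>edges. lf e)"
  proof (rule MMFlow_le[where \<phi> = "\<lambda>q x. vertex_pot (fst q - 2 * M) x / real l"])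
    show "finite pairs" by (simp add: pairs_image)
    fix q e assume q: "q \<in> pairs" and e: "e \<in> edges"
    have "fst q - 2 * M < p" using q by (auto simp: pairs_def)
    from vertex_pot_edge[OF this e]
    show "vertex_pot (fst q - 2 * M) (snd e) / real l - vertex_pot (fst q - 2 * M) (fst e) / real l \<le> lf e"
      using l by (auto simp: lf_def diff_divide_distrib[symmetric] divide_right_mono divide_nonpos_pos)
  qed (use l in \<open>auto simp: finite_edges pairs_def vertex_pot_def lf_def\<close>)
  also have "\<dots> = (\<Sum>e\<in>{e \<in> edges. fst e < M}. 1 / real l)"
    unfolding lf_def using finite_edges by (subst sum.inter_filter) auto
  also have "{e \<in> edges. fst e < M} = (\<lambda>b. (b, M + b)) ` {..<M}"
  proof
    show "{e \<in> edges. fst e < M} \<subseteq> (\<lambda>b. (b, M + b)) ` {..<M}"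
    proof
      fix e assume "e \<in> {e \<in> edges. fst e < M}"
      then have e: "e \<in> edges" and f: "fst e < M" by auto
      from e show "e \<in> (\<lambda>b. (b, M + b)) ` {..<M}" using f by (cases rule: edges_cases) auto
    qed
    show "(\<lambda>b. (b, M + b)) ` {..<M} \<subseteq> {e \<in> edges. fst e < M}" by (auto simp: edges_def)
  qed
  also have "(\<Sum>e\<in>(\<lambda>b. (b, M + b)) ` {..<M}. 1 / real l) = real M / real l"
    by (subst sum.reindex) (auto simp: inj_on_def)
  finally show ?thesis .
qed

text \<open>Every edge is charged to an incident bottleneck, so that cutting edges is no better than cutting bottlenecks.\<close>

definition charge :: "nat \<times> nat \<Rightarrow> nat" where
  "charge e = (if snd e < M then snd e else if snd e < 2 * M then snd e - M else fst e - M)"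

text \<open>A multicut of at most \<open>M / 8\<close> edges charges at most as many bottlenecks, so
  some path still climbs to level \<open>l\<close> without them. All edges of its route are charged
  to bottlenecks outside \<open>C\<close> and hence are uncut.\<close>

lemma MCut_lower:
  assumes robust: "\<And>C. C \<subseteq> {..<M} \<Longrightarrow> 8 * card C \<le> M \<Longrightarrow>
      \<exists>i<p. l \<le> reach (\<lambda>v. {b. b < M \<and> own b = v}) (lev i) C (Ps ! i) 0"
  shows "M < 8 * MCut edges pairs"
proof (rule ccontr)
  assume small: "\<not> ?thesis"
  obtain D where D: "is_multicut edges pairs D" "MCut edges pairs = card D"
    by (rule MCut_attained[of pairs edges]) (auto simp: pairs_def)
  have Dsub: "D \<subseteq> edges" using D(1) by (simp add: is_multicut_def)
  then have finD: "finite D" using finite_edges finite_subset by blast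
  define C where "C = charge ` D"
  have "C \<subseteq> {..<M}"
  proof
    fix c assume "c \<in> C"
    then obtain e where e: "e \<in> edges" "c = charge e" using Dsub by (auto simp: C_def)
    from e(1) show "c \<in> {..<M}" unfolding e(2) by (cases rule: edges_cases) (auto simp: charge_def)
  qed
  moreover have "8 * card C \<le> M" using card_image_le[OF finD, of charge] small D(2) by (simp add: C_def)
  ultimately obtain i where i: "i < p"
    and ri: "l \<le> reach (\<lambda>v. {b. b < M \<and> own b = v}) (lev i) C (Ps ! i) 0"
    using robust by blast
  define s where "s = reach (\<lambda>v. {b. b < M \<and> own b = v}) (lev i) C (Ps ! i) 0"
  obtain g where g: "\<forall>j. 0 \<le> j \<and> j < s \<longrightarrow> g j < M \<and> g j \<notin> C \<and> lev i (g j) = j \<and> own (g j) \<in> set (Ps ! i)"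
    "\<forall>j. 0 \<le> j \<and> Suc j < s \<longrightarrow> prec (Ps ! i) (own (g j)) (own (g (Suc j)))"
    using reach_chain[of "\<lambda>v. {b. b < M \<and> own b = v}" M "\<lambda>b. own b" "lev i" C "Ps ! i" 0 s] s_def by auto
  have ls: "l \<le> s" using ri by (simp add: s_def)
  have l0: "0 < l" using lev_less[of 0 0] by simp
  have gj: "g j < M" "g j \<notin> C" "lev i (g j) = j" "own (g j) \<in> set (Ps ! i)" if "j < l" for j
    using g(1) that ls by auto
  have avail: "e \<in> edges - D" if "e \<in> edges" "charge e = g j" "j < l" for e j
  proof -
    have "charge e \<notin> charge ` D" using that gj(2)[of j] by (simp add: C_def)
    then show ?thesis using that(1) by blast
  qed
  have bott: "(g j, M + g j) \<in> edges - D" if "j < l" for j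
    by (rule avail[OF _ _ that]) (use gj(1)[OF that] in \<open>auto simp: edges_def charge_def\<close>)
  have "(2 * M + i, M + g j) \<in> (edges - D)\<^sup>*" if "j < l" for j
    using that
  proof (induction j)
    case 0
    have "(2 * M + i, g 0) \<in> edges - D"
      by (rule avail[OF _ _ l0]) (use gj[OF l0] i in \<open>auto simp: edges_def charge_def\<close>)
    then show ?case using bott[OF l0] by (meson converse_rtrancl_into_rtrancl r_into_rtrancl)
  next
    case (Suc j)
    then have j: "j < l" by simp
    have "(M + g j, g (Suc j)) \<in> edges - D"
    proof (rule avail[OF _ _ Suc.prems])
      have "prec (Ps ! i) (own (g j)) (own (g (Suc j)))" using g(2) Suc.prems ls by auto
      then show "(M + g j, g (Suc j)) \<in> edges"
        unfolding edges_def using gj[OF j] gj[OF Suc.prems] i by auto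
      show "charge (M + g j, g (Suc j)) = g (Suc j)" using gj[OF Suc.prems] by (simp add: charge_def)
    qed
    then show ?case using Suc.IH[OF j] bott[OF Suc.prems] by (meson rtrancl.rtrancl_into_rtrancl)
  qed
  from this[of "l - 1"] have a: "(2 * M + i, M + g (l - 1)) \<in> (edges - D)\<^sup>*" using l0 by simp
  have "(M + g (l - 1), 2 * M + p + i) \<in> edges - D"
    by (rule avail[of _ "l - 1"]) (use gj[of "l - 1"] l0 i in \<open>auto simp: edges_def charge_def\<close>)
  then have "(2 * M + i, 2 * M + p + i) \<in> (edges - D)\<^sup>*" using a by (rule rtrancl.rtrancl_into_rtrancl[rotated])
  then show False using D(1) i by (auto simp: is_multicut_def pairs_def)
qed

end

text \<open>The cut exceeds \<open>M / 8\<close> and the flow is at most \<open>M / l\<close>;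
  surplus vertices up to \<open>N\<close> stay isolated.\<close>

lemma MCG_lower_bound:
  assumes "acyclic_system Ps rank" and dist: "\<forall>vs\<in>set Ps. distinct vs" and l: "0 < l"
    and big: "32 * l * card (set (concat Ps)) \<le> ps_size Ps" "32 * l * length Ps \<le> ps_size Ps"
    and M: "0 < ps_size Ps" and N: "2 * ps_size Ps + 2 * length Ps \<le> N"
  shows "l \<le> 8 * MCG N"
proof -
  have size: "length (concat Ps) = ps_size Ps" by (simp add: ps_size_def length_concat)
  obtain lev where lev: "\<And>i b. lev i b < l"
    "\<And>C. C \<subseteq> {..<length (concat Ps)} \<Longrightarrow> 8 * card C \<le> length (concat Ps) \<Longrightarrow>
       \<exists>i<length Ps. l \<le> reach (\<lambda>v. {b. b < length (concat Ps) \<and> concat Ps ! b = v}) (lev i) C (Ps ! i) 0"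
    using levels_exist[OF dist l] big M unfolding size by blast
  interpret acyclic_system Ps rank by fact
  interpret gap_instance Ps rank lev l by unfold_locales (rule lev(1))
  have "digraph {..<N} edges" using edges_subset N size by (force simp: digraph_def)
  moreover have "demands {..<N} pairs" using N size by (auto simp: demands_def pairs_def)
  ultimately have "real (MCut edges pairs) \<le> real (MCG N) * MMFlow edges pairs"
    by (intro MCG_property) auto
  also have "\<dots> \<le> real (MCG N) * (real M / real l)" using MMFlow_upper by (intro mult_left_mono) auto
  finally have "real l * real (MCut edges pairs) \<le> real (MCG N) * real M" using l by (simp add: field_simps)
  moreover have "real M \<le> 8 * real (MCut edges pairs)" using MCut_lower[OF lev(2)] by linarith
  moreover from this have "real l * real M \<le> real l * (8 * real (MCut edges pairs))"
    by (rule mult_left_mono) simp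
  ultimately have "real l * real M \<le> 8 * (real (MCG N) * real M)" by linarith
  then have "real M * real l \<le> real M * (8 * real (MCG N))" by (simp add: mult_ac)
  moreover have "0 < real M" using M size by simp
  ultimately have "real l \<le> 8 * real (MCG N)" by (rule mult_le_cancel_left_pos[THEN iffD1, rotated])
  then show ?thesis by linarith
qed

section \<open>Sparse cuts in bridgeless systems\<close>

lemma sum_card_swap:
  assumes "finite A" "finite B"
  shows "(\<Sum>a\<in>A. card {b \<in> B. R a b}) = (\<Sum>b\<in>B. card {a \<in> A. R a b})"
proof -
  have "(\<Sum>a\<in>A. card {b \<in> B. R a b}) = (\<Sum>a\<in>A. \<Sum>b\<in>B. if R a b then 1 else 0)"
    using assms by (intro sum.cong refl) (simp add: sum.If_cases Int_def)
  also have "\<dots> = (\<Sum>b\<in>B. \<Sum>a\<in>A. if R a b then 1 else 0)" by (rule sum.swap)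
  also have "\<dots> = (\<Sum>b\<in>B. card {a \<in> A. R a b})"
    using assms by (intro sum.cong refl) (simp add: sum.If_cases Int_def)
  finally show ?thesis .
qed

text \<open>A uniform choice among \<open>2 * D\<close> classes: a node has at most
  \<open>D ^ k\<close> sets of \<open>k\<close> paths, each falls into a given class with
  probability \<open>1 / (2 * D) ^ k\<close>, and the union over nodes and classes leaves
  \<open>card W * (2 * D) / 2 ^ k\<close>, which is below 1.\<close>

lemma balanced_classes:
  assumes W: "finite W" and D: "0 < D" "\<And>w. w \<in> W \<Longrightarrow> card {a \<in> {..<p::nat}. R w a} \<le> D"
    and k: "card W * (2 * D) < 2 ^ k"
  obtains cls :: "nat \<Rightarrow> nat" where "\<And>a. cls a < 2 * D"
    "\<And>w j. w \<in> W \<Longrightarrow> card {a \<in> {..<p}. R w a \<and> cls a = j} < k"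
proof -
  define m where "m = 2 * D"
  define F where "F = {..<p} \<rightarrow>\<^sub>E {..<m}"
  define T where "T = (\<lambda>w. {A. A \<subseteq> {a \<in> {..<p}. R w a} \<and> card A = k})"
  define bad where "bad = (\<Union>w\<in>W. \<Union>j\<in>{..<m}. \<Union>A\<in>T w. {f \<in> F. \<forall>a\<in>A. f a = j})"
  have finF: "finite F" and cF: "card F = m ^ p" by (auto simp: F_def finite_PiE card_PiE)
  have finT: "finite (T w)" for w unfolding T_def by (rule finite_subset[of _ "Pow {..<p}"]) auto
  have cT: "card (T w) \<le> D ^ k" if "w \<in> W" for w
  proof -
    have "card (T w) = card {a \<in> {..<p}. R w a} choose k" unfolding T_def by (rule n_subsets) simp
    also have "\<dots> \<le> card {a \<in> {..<p}. R w a} ^ k"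
    proof (cases "k \<le> card {a \<in> {..<p}. R w a}")
      case True then show ?thesis by (rule binomial_le_pow)
    next
      case False then show ?thesis by (subst binomial_eq_0) auto
    qed
    also have "\<dots> \<le> D ^ k" using D(2)[OF that] by (intro power_mono) auto
    finally show ?thesis .
  qed
  have one: "card {f \<in> F. \<forall>a\<in>A. f a = j} * m ^ k \<le> m ^ p" if A: "A \<in> T w" and j: "j < m" for A w j
  proof -
    have A': "A \<subseteq> {..<p}" "card A = k" "finite A"
      using A finite_subset[of A "{..<p}"] by (auto simp: T_def)
    have "{f \<in> F. \<forall>a\<in>A. f a = j} = (\<Pi>\<^sub>E a\<in>{..<p}. if a \<in> A then {j} else {..<m})"
      using A' j by (auto simp: F_def PiE_iff extensional_def split: if_splits)
    then have "card {f \<in> F. \<forall>a\<in>A. f a = j} = (\<Prod>a\<in>{..<p}. if a \<in> A then 1 else m)"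
      by (auto simp: card_PiE intro!: prod.cong)
    also have "\<dots> = m ^ card ({..<p} - A)"
      using A' by (simp add: prod.If_cases Diff_eq)
    also have "\<dots> = m ^ (p - k)" using A' by (simp add: card_Diff_subset)
    finally have "card {f \<in> F. \<forall>a\<in>A. f a = j} * m ^ k = m ^ (p - k + k)" by (simp add: power_add)
    moreover have "k \<le> p" using A' card_mono[of "{..<p}" A] by auto
    ultimately show ?thesis by simp
  qed
  have "card bad * m ^ k \<le> (card W * m * D ^ k) * m ^ p"
  proof -
    have "card bad \<le> (\<Sum>w\<in>W. card (\<Union>j\<in>{..<m}. \<Union>A\<in>T w. {f \<in> F. \<forall>a\<in>A. f a = j}))"
      unfolding bad_def by (rule card_UN_le[OF W])
    also have "\<dots> \<le> (\<Sum>w\<in>W. \<Sum>j\<in>{..<m}. card (\<Union>A\<in>T w. {f \<in> F. \<forall>a\<in>A. f a = j}))"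
      by (intro sum_mono card_UN_le) auto
    also have "\<dots> \<le> (\<Sum>w\<in>W. \<Sum>j\<in>{..<m}. \<Sum>A\<in>T w. card {f \<in> F. \<forall>a\<in>A. f a = j})"
      by (intro sum_mono card_UN_le finT)
    finally have "card bad * m ^ k \<le> (\<Sum>w\<in>W. \<Sum>j\<in>{..<m}. \<Sum>A\<in>T w. card {f \<in> F. \<forall>a\<in>A. f a = j}) * m ^ k"
      by (rule mult_right_mono) simp
    also have "\<dots> = (\<Sum>w\<in>W. \<Sum>j\<in>{..<m}. \<Sum>A\<in>T w. card {f \<in> F. \<forall>a\<in>A. f a = j} * m ^ k)"
      by (simp add: sum_distrib_right)
    also have "\<dots> \<le> (\<Sum>w\<in>W. \<Sum>j\<in>{..<m}. \<Sum>A\<in>T w. m ^ p)"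
      by (intro sum_mono one) auto
    also have "\<dots> \<le> (\<Sum>w\<in>W. \<Sum>j\<in>{..<m}. D ^ k * m ^ p)"
      using cT by (intro sum_mono) (simp add: mult_right_mono)
    finally show ?thesis by (simp add: mult_ac)
  qed
  also have "\<dots> < (2 ^ k * D ^ k) * m ^ p"
    using k D(1) by (intro mult_strict_right_mono) (auto simp: m_def)
  also have "\<dots> = card F * m ^ k" by (simp add: m_def cF power_mult_distrib)
  finally have "card bad < card F" by simp
  moreover have "bad \<subseteq> F" by (auto simp: bad_def)
  ultimately obtain f where f: "f \<in> F" "f \<notin> bad" by (metis less_irrefl subset_antisym subsetI)
  define cls where "cls = (\<lambda>a. if a < p then f a else 0)"
  show ?thesis
  proof
    show "cls a < 2 * D" for a using f(1) D(1) by (auto simp: cls_def F_def m_def PiE_iff)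
    fix w j assume w: "w \<in> W"
    show "card {a \<in> {..<p}. R w a \<and> cls a = j} < k"
    proof (rule ccontr)
      assume "\<not> ?thesis"
      then obtain A where A: "A \<subseteq> {a \<in> {..<p}. R w a \<and> cls a = j}" "card A = k"
        by (meson not_less obtain_subset_with_card_n)
      show False
      proof (cases "j < m")
        case True
        have "A \<in> T w" "\<forall>a\<in>A. f a = j" using A by (auto simp: T_def cls_def)
        then have "f \<in> bad" unfolding bad_def using f(1) w True by blast
        then show False using f(2) by simp
      next
        case False
        then have "A = {}" using A(1) f(1) by (force simp: cls_def F_def PiE_iff)
        then show False using A(2) k D(1) w W by (auto simp: card_gt_0_iff)
      qed
    qed
  qed
qed

section \<open>Rainbow walks, expansion and sparse cuts\<close>

context
  fixes Ps :: "nat list list"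
begin

text \<open>The flag lets one argument grow both the forward closure (\<open>True\<close>) and the
  backward closure (\<open>False\<close>).\<close>

definition hop :: "bool \<Rightarrow> nat \<Rightarrow> nat \<Rightarrow> nat \<Rightarrow> bool" where
  "hop d a x y \<longleftrightarrow> (if d then prec (Ps ! a) x y else prec (Ps ! a) y x)"

lemma hop_in_set: "hop d a x y \<Longrightarrow> x \<in> set (Ps ! a) \<and> y \<in> set (Ps ! a)"
  using prec_in_set by (auto simp: hop_def split: if_splits)

text \<open>\<open>rwalk d S x y\<close>: a walk from \<open>x\<close> to \<open>y\<close> that uses each path in \<open>S\<close> exactly once.\<close>

inductive rwalk :: "bool \<Rightarrow> nat set \<Rightarrow> nat \<Rightarrow> nat \<Rightarrow> bool" for d where
  rwalk_refl: "rwalk d {} x x"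
| rwalk_step: "rwalk d S x y \<Longrightarrow> a \<notin> S \<Longrightarrow> hop d a y z \<Longrightarrow> rwalk d (insert a S) x z"

lemma rwalk_trans:
  "rwalk d S' y z \<Longrightarrow> rwalk d S x y \<Longrightarrow> S \<inter> S' = {} \<Longrightarrow> rwalk d (S \<union> S') x z"
proof (induction rule: rwalk.induct)
  case (rwalk_step S' y w a z)
  then have "rwalk d (insert a (S \<union> S')) x z" by (intro rwalk.rwalk_step) auto
  then show ?case by simp
qed simp

lemma rwalk_reverse: "rwalk False S x y \<Longrightarrow> rwalk True S y x"
proof (induction rule: rwalk.induct)
  case (rwalk_step S x y a z)
  have "rwalk True {a} z y"
    using rwalk.rwalk_step[OF rwalk_refl[of True z], of a y] rwalk_step.hyps by (simp add: hop_def)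
  from rwalk_trans[OF rwalk_step.IH this] show ?case using rwalk_step.hyps by simp
qed (rule rwalk_refl)

lemma rwalk_fun:
  "rwalk d S x y \<Longrightarrow> \<exists>m vs ks. vs 0 = x \<and> vs m = y \<and> inj_on ks {..<m} \<and> ks ` {..<m} = S \<and>
     (\<forall>j<m. hop d (ks j) (vs j) (vs (Suc j)))"
proof (induction rule: rwalk.induct)
  case (rwalk_refl x)
  then show ?case by (intro exI[of _ 0] exI[of _ "\<lambda>_. x"]) auto
next
  case (rwalk_step S x y a z)
  then obtain m vs ks where w: "vs 0 = x" "vs m = y" "inj_on ks {..<m}" "ks ` {..<m} = S"
    "\<forall>j<m. hop d (ks j) (vs j) (vs (Suc j))" by blast
  have "inj_on (ks(m := a)) {..<Suc m}"
    using w(3,4) rwalk_step.hyps(2) by (auto simp: inj_on_def lessThan_Suc)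
  moreover have "(ks(m := a)) ` {..<Suc m} = insert a S" using w(4) by (auto simp: lessThan_Suc)
  moreover have "hop d ((ks(m := a)) j) ((vs(Suc m := z)) j) ((vs(Suc m := z)) (Suc j))" if "j < Suc m" for j
    using that w(2,5) rwalk_step.hyps(3) by (cases "j = m") auto
  moreover have "(vs(Suc m := z)) 0 = x" "(vs(Suc m := z)) (Suc m) = z" using w(1) by auto
  ultimately show ?case
    by (rule_tac exI[of _ "Suc m"], rule_tac exI[of _ "vs(Suc m := z)"], rule_tac exI[of _ "ks(m := a)"]) blast
qed

lemma no_rwalk_along_chord:
  assumes "bridgeless Ps" "t < length Ps" "prec (Ps ! t) u v" "u \<noteq> v"
    and "rwalk True S u v" "S \<subseteq> {..<length Ps} - {t}"
  shows False
proof -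
  obtain m vs ks where w: "vs 0 = u" "vs m = v" "inj_on ks {..<m}" "ks ` {..<m} = S"
    "\<forall>j<m. hop True (ks j) (vs j) (vs (Suc j))" using rwalk_fun[OF assms(5)] by blast
  then show False
    using bridgeless_no_rainbow_walk[OF assms(1,2), of ks m vs] assms(3,4,6) by (auto simp: hop_def)
qed

text \<open>\<open>Dr a\<close> is the set of nodes to be dropped from path \<open>a\<close>.\<close>

definition separates :: "bool \<Rightarrow> nat set \<Rightarrow> nat set \<Rightarrow> (nat \<Rightarrow> nat set) \<Rightarrow> bool" where
  "separates d X Z Dr \<longleftrightarrow> (\<forall>a<length Ps. \<forall>z\<in>Z - Dr a. \<forall>w\<in>X - Z - Dr a. \<not> hop d a z w)"

definition cost :: "(nat \<Rightarrow> nat set) \<Rightarrow> nat" where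
  "cost Dr = (\<Sum>a<length Ps. card (Dr a \<inter> set (Ps ! a)))"

definition nbhd :: "bool \<Rightarrow> (nat \<Rightarrow> nat) \<Rightarrow> nat \<Rightarrow> nat \<Rightarrow> nat set \<Rightarrow> nat set \<Rightarrow> nat set" where
  "nbhd d cls t j X Z = {w \<in> X - Z. \<exists>a<length Ps. a \<noteq> t \<and> cls a = j \<and> (\<exists>z\<in>Z. hop d a z w)}"

lemma grow_step:
  assumes X: "finite X" "X \<subseteq> W" and Z: "Z \<subseteq> X" and U: "U \<subseteq> {..<m}" "card U < m"
    and cls: "\<And>a. cls a < m"
    and k: "0 < k" "\<And>w j. w \<in> W \<Longrightarrow> card {a \<in> {..<length Ps}. w \<in> set (Ps ! a) \<and> cls a = j} \<le> k"
    and exp: "\<And>Dr. separates d X Z Dr \<Longrightarrow> th * card Z < cost Dr"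
    and th: "2 * (card U * k + 1) \<le> th" and G: "2 * k * m \<le> G * th"
  shows "\<exists>j<m. j \<notin> U \<and> card Z \<le> G * card (nbhd d cls t j X Z)"
proof -
  define p where "p = length Ps"
  define av where "av = {a. a < p \<and> a \<noteq> t \<and> cls a \<notin> U}"
  define J where "J = {..<m} - U"
  define N where "N = (\<lambda>j. nbhd d cls t j X Z)"
  \<comment> \<open>On available paths the one-hop neighbours of \<open>Z\<close> are dropped, on
    all others \<open>Z\<close> itself, so no hop from \<open>Z\<close> into \<open>X - Z\<close>
    survives.\<close>
  define Dr where "Dr = (\<lambda>a. if a \<in> av then {w \<in> X - Z. w \<in> set (Ps ! a) \<and> (\<exists>z\<in>Z. hop d a z w)} else Z)"
  have finZ: "finite Z" using X Z finite_subset by blast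
  have av: "av \<subseteq> {..<p}" "finite av" by (auto simp: av_def)
  have "separates d X Z Dr"
    unfolding separates_def Dr_def using hop_in_set by (auto split: if_splits)
  from exp[OF this] have "th * card Z < (\<Sum>a<p. card (Dr a \<inter> set (Ps ! a)))" by (simp add: cost_def p_def)
  also have "\<dots> = (\<Sum>a\<in>av. card (Dr a \<inter> set (Ps ! a))) + (\<Sum>a\<in>{..<p} - av. card (Dr a \<inter> set (Ps ! a)))"
    using av by (simp add: sum.subset_diff add.commute)
  also have "(\<Sum>a\<in>{..<p} - av. card (Dr a \<inter> set (Ps ! a))) = (\<Sum>a\<in>{..<p} - av. card {z \<in> Z. z \<in> set (Ps ! a)})"
    by (intro sum.cong refl arg_cong[of _ _ card]) (auto simp: Dr_def)
  also have "\<dots> = (\<Sum>z\<in>Z. card {a \<in> {..<p} - av. z \<in> set (Ps ! a)})"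
    using finZ by (intro sum_card_swap) auto
  \<comment> \<open>A node meets at most \<open>k\<close> paths of each used class, and possibly
    \<open>t\<close>; by the choice of \<open>th\<close> this amounts to at most half of
    \<open>th * card Z\<close>.\<close>
  also have "\<dots> \<le> (\<Sum>z\<in>Z. card U * k + 1)"
  proof (rule sum_mono)
    fix z assume z: "z \<in> Z"
    have finU: "finite U" using U finite_subset by blast
    have "{a \<in> {..<p} - av. z \<in> set (Ps ! a)} \<subseteq> (\<Union>j\<in>U. {a \<in> {..<p}. z \<in> set (Ps ! a) \<and> cls a = j}) \<union> {t}"
      by (auto simp: av_def)
    then have "card {a \<in> {..<p} - av. z \<in> set (Ps ! a)}
        \<le> card ((\<Union>j\<in>U. {a \<in> {..<p}. z \<in> set (Ps ! a) \<and> cls a = j}) \<union> {t})"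
      using finU by (intro card_mono) auto
    also have "\<dots> \<le> card (\<Union>j\<in>U. {a \<in> {..<p}. z \<in> set (Ps ! a) \<and> cls a = j}) + card {t}" by (rule card_Un_le)
    also have "card (\<Union>j\<in>U. {a \<in> {..<p}. z \<in> set (Ps ! a) \<and> cls a = j})
        \<le> (\<Sum>j\<in>U. card {a \<in> {..<p}. z \<in> set (Ps ! a) \<and> cls a = j})" by (rule card_UN_le[OF finU])
    also have "\<dots> \<le> (\<Sum>j\<in>U. k)" using k(2) z Z X unfolding p_def by (intro sum_mono) blast
    finally show "card {a \<in> {..<p} - av. z \<in> set (Ps ! a)} \<le> card U * k + 1" by simp
  qed
  also have "(\<Sum>a\<in>av. card (Dr a \<inter> set (Ps ! a))) = (\<Sum>a\<in>av. card {w \<in> X - Z. w \<in> Dr a})"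
    by (intro sum.cong refl arg_cong[of _ _ card]) (auto simp: Dr_def)
  also have "\<dots> = (\<Sum>w\<in>X - Z. card {a \<in> av. w \<in> Dr a})"
    using X av by (intro sum_card_swap) auto
  also have "\<dots> \<le> (\<Sum>w\<in>X - Z. \<Sum>j\<in>J. if w \<in> N j then k else 0)"
  proof (rule sum_mono)
    fix w assume w: "w \<in> X - Z"
    have "{a \<in> av. w \<in> Dr a} \<subseteq> (\<Union>j\<in>J. {a \<in> av. w \<in> Dr a \<and> cls a = j})"
      using cls by (auto simp: J_def av_def)
    then have "card {a \<in> av. w \<in> Dr a} \<le> card (\<Union>j\<in>J. {a \<in> av. w \<in> Dr a \<and> cls a = j})"
      using av by (intro card_mono) (auto simp: J_def)
    also have "\<dots> \<le> (\<Sum>j\<in>J. card {a \<in> av. w \<in> Dr a \<and> cls a = j})" by (rule card_UN_le) (simp add: J_def)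
    also have "\<dots> \<le> (\<Sum>j\<in>J. if w \<in> N j then k else 0)"
    proof (rule sum_mono)
      fix j assume "j \<in> J"
      show "card {a \<in> av. w \<in> Dr a \<and> cls a = j} \<le> (if w \<in> N j then k else 0)"
      proof (cases "w \<in> N j")
        case True
        have "card {a \<in> av. w \<in> Dr a \<and> cls a = j} \<le> card {a \<in> {..<p}. w \<in> set (Ps ! a) \<and> cls a = j}"
          by (intro card_mono) (auto simp: Dr_def av_def)
        also have "\<dots> \<le> k" using k(2) w X unfolding p_def by blast
        finally show ?thesis using True by simp
      next
        case False
        then have "{a \<in> av. w \<in> Dr a \<and> cls a = j} = {}"
          by (auto simp: N_def nbhd_def Dr_def av_def p_def)
        then show ?thesis by (simp only: card.empty)
      qed
    qed
    finally show "card {a \<in> av. w \<in> Dr a} \<le> (\<Sum>j\<in>J. if w \<in> N j then k else 0)" .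
  qed
  also have "\<dots> = (\<Sum>j\<in>J. \<Sum>w\<in>X - Z. if w \<in> N j then k else 0)" by (rule sum.swap)
  also have "\<dots> = (\<Sum>j\<in>J. k * card (N j))"
  proof (intro sum.cong refl)
    fix j
    have "(X - Z) \<inter> {w. w \<in> N j} = N j" by (auto simp: N_def nbhd_def)
    then show "(\<Sum>w\<in>X - Z. if w \<in> N j then k else 0) = k * card (N j)"
      using X by (simp add: sum.If_cases)
  qed
  finally have main: "th * card Z < (\<Sum>j\<in>J. k * card (N j)) + card Z * (card U * k + 1)" by simp
  have half: "th * card Z \<le> 2 * (\<Sum>j\<in>J. k * card (N j))"
  proof -
    have "2 * (card Z * (card U * k + 1)) \<le> th * card Z" using mult_right_mono[OF th, of "card Z"] by (simp add: mult_ac)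
    then show ?thesis using main by linarith
  qed
  show ?thesis
  proof (rule ccontr)
    assume "\<not> ?thesis"
    \<comment> \<open>If every fresh class fell short of \<open>card Z / G\<close>, then at most
      \<open>m\<close> classes could not supply the required total
      \<open>th * card Z / (2 * k)\<close>.\<close>
    then have small: "G * card (N j) < card Z" if "j \<in> J" for j using that by (auto simp: J_def N_def not_le)
    have J: "finite J" "card J \<le> m" by (auto simp: J_def intro: card_mono[of "{..<m}", simplified])
    have "J \<noteq> {}"
    proof
      assume "J = {}"
      then have "{..<m} \<subseteq> U" by (auto simp: J_def)
      then have "m \<le> card U" using U(1) card_mono[of U "{..<m}"] finite_subset by auto
      then show False using U(2) by simp
    qed
    have "(\<Sum>j\<in>J. G * card (N j)) < (\<Sum>j\<in>J. card Z)" using J \<open>J \<noteq> {}\<close> small by (intro sum_strict_mono) auto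
    also have "\<dots> \<le> m * card Z" using J(2) by (simp add: mult_right_mono)
    finally have a: "G * (\<Sum>j\<in>J. card (N j)) < m * card Z" by (simp add: sum_distrib_left)
    have "2 * k * (m * card Z) \<le> G * (th * card Z)" using mult_right_mono[OF G, of "card Z"] by (simp add: mult_ac)
    also have "\<dots> \<le> G * (2 * (\<Sum>j\<in>J. k * card (N j)))" using half by (intro mult_left_mono) auto
    also have "\<dots> = 2 * k * (G * (\<Sum>j\<in>J. card (N j)))" by (simp add: sum_distrib_left mult_ac)
    finally have "2 * k * (m * card Z) \<le> 2 * k * (G * (\<Sum>j\<in>J. card (N j)))" .
    then have "m * card Z \<le> G * (\<Sum>j\<in>J. card (N j))" using k(1) by simp
    then show False using a by simp
  qed
qed

text \<open>Until \<open>Z\<close> exceeds half of \<open>X\<close>, every round enlarges it by a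
  factor \<open>1 + 1 / G\<close> and consumes one fresh class, so the walks never repeat a path.
  \<open>U0\<close> holds the classes reserved for the opposite search, and \<open>T\<close> bounds
  all classes in use.\<close>

lemma grow_iterate:
  assumes X: "finite X" "X \<subseteq> W" and u: "u \<in> X" and U0: "U0 \<subseteq> {..<m}"
    and cls: "\<And>a. cls a < m"
    and k: "0 < k" "\<And>w j. w \<in> W \<Longrightarrow> card {a \<in> {..<length Ps}. w \<in> set (Ps ! a) \<and> cls a = j} \<le> k"
    and exp: "\<And>Z Dr. Z \<subseteq> X \<Longrightarrow> Z \<noteq> {} \<Longrightarrow> 2 * card Z \<le> card X \<Longrightarrow> separates d X Z Dr \<Longrightarrow> th * card Z < cost Dr"
    and th: "2 * (T * k + 1) \<le> th" and G: "2 * k * m \<le> G * th" and m: "T < m"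
  shows "card U0 + n \<le> T \<Longrightarrow> \<exists>Z U. Z \<subseteq> X \<and> u \<in> Z \<and> U \<subseteq> {..<m} - U0 \<and> card U \<le> n \<and>
    (card X < 2 * card Z \<or> (G + 1) ^ n \<le> G ^ n * card Z) \<and>
    (\<forall>w\<in>Z. \<exists>S. rwalk d S u w \<and> S \<subseteq> {a. a < length Ps \<and> a \<noteq> t \<and> cls a \<in> U})"
proof (induction n)
  case 0
  show ?case using u by (rule_tac exI[of _ "{u}"], rule_tac exI[of _ "{}"]) (auto intro!: exI[of _ "{}"] rwalk_refl)
next
  case (Suc n)
  then obtain Z U where Z: "Z \<subseteq> X" "u \<in> Z" and U: "U \<subseteq> {..<m} - U0" "card U \<le> n"
    and size: "card X < 2 * card Z \<or> (G + 1) ^ n \<le> G ^ n * card Z"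
    and walk: "\<forall>w\<in>Z. \<exists>S. rwalk d S u w \<and> S \<subseteq> {a. a < length Ps \<and> a \<noteq> t \<and> cls a \<in> U}" by auto
  show ?case
  proof (cases "card X < 2 * card Z")
    case True
    then show ?thesis using Z U walk by (rule_tac exI[of _ Z], rule_tac exI[of _ U]) auto
  next
    case False
    have fin: "finite U" "finite U0" "finite Z" using U U0 Z X by (auto intro: finite_subset)
    have cU: "card (U0 \<union> U) \<le> T" using card_Un_le[of U0 U] U(2) Suc.prems by linarith
    have th': "2 * (card (U0 \<union> U) * k + 1) \<le> th"
      by (rule order_trans[OF _ th]) (intro mult_left_mono add_right_mono mult_right_mono cU, auto)
    have "\<exists>j<m. j \<notin> U0 \<union> U \<and> card Z \<le> G * card (nbhd d cls t j X Z)"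
    proof (rule grow_step[OF X Z(1) _ _ cls k _ th' G])
      show "U0 \<union> U \<subseteq> {..<m}" using U U0 by auto
      show "card (U0 \<union> U) < m" using cU m by simp
      show "th * card Z < cost Dr" if "separates d X Z Dr" for Dr
        using exp[OF Z(1) _ _ that] Z(2) False by auto
    qed
    then obtain j where j: "j < m" "j \<notin> U0" "j \<notin> U" "card Z \<le> G * card (nbhd d cls t j X Z)" by auto
    let ?N = "nbhd d cls t j X Z"
    have N: "?N \<subseteq> X" "?N \<inter> Z = {}" "finite ?N" using X by (auto simp: nbhd_def)
    have "(G + 1) ^ Suc n \<le> G ^ Suc n * card (Z \<union> ?N)"
    proof -
      have "(G + 1) ^ n \<le> G ^ n * card Z" using size False by blast
      then have "(G + 1) ^ Suc n \<le> (G + 1) * (G ^ n * card Z)" unfolding power_Suc by (rule mult_left_mono) simp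
      also have "\<dots> = G ^ n * (G * card Z + card Z)" by (simp add: algebra_simps)
      also have "\<dots> \<le> G ^ n * (G * card Z + G * card ?N)" using j(4) by (intro mult_left_mono) auto
      also have "\<dots> = G ^ Suc n * card (Z \<union> ?N)"
        using N fin by (subst card_Un_disjoint) (auto simp: algebra_simps)
      finally show ?thesis .
    qed
    moreover have "\<exists>S. rwalk d S u w \<and> S \<subseteq> {a. a < length Ps \<and> a \<noteq> t \<and> cls a \<in> insert j U}" if w: "w \<in> Z \<union> ?N" for w
    proof (cases "w \<in> Z")
      case True
      then show ?thesis using walk by blast
    next
      case False
      then obtain a z where a: "a < length Ps" "a \<noteq> t" "cls a = j" "z \<in> Z" "hop d a z w"
        using w by (auto simp: nbhd_def)
      obtain S where S: "rwalk d S u z" "S \<subseteq> {a. a < length Ps \<and> a \<noteq> t \<and> cls a \<in> U}" using walk a(4) by blast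
      have "a \<notin> S" using S(2) a(3) j(3) by auto
      then have "rwalk d (insert a S) u w" using rwalk_step[OF S(1) _ a(5)] by blast
      then show ?thesis using S(2) a(1-3) by (intro exI[of _ "insert a S"]) auto
    qed
    moreover have "card (insert j U) \<le> Suc n" using U(2) fin(1) j(3) by simp
    ultimately show ?thesis using Z U j N
      by (rule_tac exI[of _ "Z \<union> ?N"], rule_tac exI[of _ "insert j U"]) blast
  qed
qed

lemma sparse_cut_exists:
  assumes bl: "bridgeless Ps" and dist: "\<forall>vs\<in>set Ps. distinct vs"
    and X: "finite X" "X \<subseteq> W" and cX: "card X < 2 ^ h"
    and chord: "t < length Ps" "prec (Ps ! t) u v" "u \<in> X" "v \<in> X"
    and cls: "\<And>a. cls a < m"
    and k: "0 < k" "\<And>w j. w \<in> W \<Longrightarrow> card {a \<in> {..<length Ps}. w \<in> set (Ps ! a) \<and> cls a = j} \<le> k"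
    and th: "2 * (2 * (G * h) * k + 1) \<le> th" and G: "2 * k * m \<le> G * th" "0 < G" and m: "2 * (G * h) < m"
  shows "\<exists>d Z Dr. Z \<subseteq> X \<and> Z \<noteq> {} \<and> 2 * card Z \<le> card X \<and> separates d X Z Dr \<and> cost Dr \<le> th * card Z"
proof (rule ccontr)
  assume "\<not> ?thesis"
  then have exp: "th * card Z < cost Dr"
    if "Z \<subseteq> X" "Z \<noteq> {}" "2 * card Z \<le> card X" "separates d X Z Dr" for d Z Dr
    using that by (meson not_le)
  \<comment> \<open>\<open>(1 + 1 / G) ^ G\<close> is at least 2 by Bernoulli, so
    \<open>G * h\<close> rounds of undisturbed growth would exceed \<open>card X\<close>; the growth
    must stop at more than half.\<close>
  have pow: "card X * G ^ (G * h) < (G + 1) ^ (G * h)"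
  proof -
    have "2 * (Suc G - 1) ^ G \<le> Suc G ^ G"
    proof -
      have "2 * real G ^ G \<le> (real G + 1) ^ G"
      proof -
        have "0 \<le> 1 / real G" by simp
        then have "- 1 \<le> 1 / real G" by linarith
        then have "1 + real G * (1 / real G) \<le> (1 + 1 / real G) ^ G" by (rule Bernoulli_inequality)
        also have "1 + 1 / real G = (real G + 1) / real G" using G(2) by (simp add: field_simps)
        finally show ?thesis using G(2) by (simp add: power_divide pos_le_divide_eq)
      qed
      then have "real (2 * G ^ G) \<le> real (Suc G ^ G)" by (simp add: add.commute)
      then show ?thesis by (simp only: of_nat_le_iff diff_Suc_1)
    qed
    then have "(2 * G ^ G) ^ h \<le> (Suc G ^ G) ^ h" by (intro power_mono) auto
    then have "2 ^ h * G ^ (G * h) \<le> (G + 1) ^ (G * h)" by (simp add: power_mult_distrib power_mult)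
    moreover have "card X * G ^ (G * h) < 2 ^ h * G ^ (G * h)" using cX G(2) by simp
    ultimately show ?thesis by linarith
  qed
  have large: "card X < 2 * card Z" if "(G + 1) ^ (G * h) \<le> G ^ (G * h) * card Z" "Z \<subseteq> X" for Z
  proof -
    have "card X * G ^ (G * h) < card Z * G ^ (G * h)"
      using less_le_trans[OF pow that(1)] by (simp only: mult.commute)
    then have "card X < card Z" by simp
    then show ?thesis by simp
  qed
  have grow: "\<exists>Z U. Z \<subseteq> X \<and> x \<in> Z \<and> U \<subseteq> {..<m} - U0 \<and> card U \<le> G * h \<and>
      (card X < 2 * card Z \<or> (G + 1) ^ (G * h) \<le> G ^ (G * h) * card Z) \<and>
      (\<forall>w\<in>Z. \<exists>S. rwalk d S x w \<and> S \<subseteq> {a. a < length Ps \<and> a \<noteq> t \<and> cls a \<in> U})"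
    if "x \<in> X" "U0 \<subseteq> {..<m}" "card U0 \<le> G * h" for d x U0
  proof (rule grow_iterate[OF X that(1,2) cls k(1) _ _ th G(1) m])
    show "card {a \<in> {..<length Ps}. w \<in> set (Ps ! a) \<and> cls a = j} \<le> k" if "w \<in> W" for w j
      using k(2)[OF that] .
    show "th * card Z < cost Dr"
      if "Z \<subseteq> X" "Z \<noteq> {}" "2 * card Z \<le> card X" "separates d X Z Dr" for Z Dr
      using exp[OF that] .
    show "card U0 + G * h \<le> 2 * (G * h)" using that(3) by simp
  qed
  obtain F U where F: "F \<subseteq> X" "U \<subseteq> {..<m}" "card U \<le> G * h"
    "card X < 2 * card F \<or> (G + 1) ^ (G * h) \<le> G ^ (G * h) * card F"
    "\<forall>w\<in>F. \<exists>S. rwalk True S u w \<and> S \<subseteq> {a. a < length Ps \<and> a \<noteq> t \<and> cls a \<in> U}"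
    using grow[OF chord(3), of "{}" True] by auto
  \<comment> \<open>The backward search avoids the classes of the forward search, so the two walks
    can be joined.\<close>
  obtain B U' where B: "B \<subseteq> X" "U' \<subseteq> {..<m} - U"
    "card X < 2 * card B \<or> (G + 1) ^ (G * h) \<le> G ^ (G * h) * card B"
    "\<forall>w\<in>B. \<exists>S. rwalk False S v w \<and> S \<subseteq> {a. a < length Ps \<and> a \<noteq> t \<and> cls a \<in> U'}"
    using grow[OF chord(4) F(2,3), of False] by auto
  have "card X < 2 * card F" "card X < 2 * card B" using F B large by blast+
  moreover have "card F + card B = card (F \<union> B) + card (F \<inter> B)"
    using F B X by (intro card_Un_Int) (auto intro: finite_subset)
  moreover have "card (F \<union> B) \<le> card X" using F B X by (intro card_mono) auto
  ultimately have "card (F \<inter> B) \<noteq> 0" by linarith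
  then have "F \<inter> B \<noteq> {}" by (metis card.empty)
  then obtain w where w: "w \<in> F" "w \<in> B" by blast
  obtain S where S: "rwalk True S u w" "S \<subseteq> {a. a < length Ps \<and> a \<noteq> t \<and> cls a \<in> U}" using F(5) w(1) by blast
  obtain S' where S': "rwalk False S' v w" "S' \<subseteq> {a. a < length Ps \<and> a \<noteq> t \<and> cls a \<in> U'}" using B(4) w(2) by blast
  have "rwalk True (S \<union> S') u v"
    by (rule rwalk_trans[OF rwalk_reverse[OF S'(1)] S(1)]) (use S(2) S'(2) B(2) in auto)
  moreover have "S \<union> S' \<subseteq> {..<length Ps} - {t}" using S(2) S'(2) by auto
  moreover have "u \<noteq> v" using prec_neq[OF _ chord(2)] dist chord(1) by simp
  ultimately show False using no_rwalk_along_chord[OF bl chord(1,2)] by blast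
qed

text \<open>Each cut is charged \<open>th\<close> per node of its smaller side, and a node is on the
  smaller side at most \<open>n\<close> times; so the recursion lowers the exponent on that side
  only.\<close>

lemma acyclic_rank:
  assumes cut: "\<And>X t u v. X \<subseteq> W \<Longrightarrow> t < length Ps \<Longrightarrow> prec (Ps ! t) u v \<Longrightarrow> u \<in> X \<Longrightarrow> v \<in> X \<Longrightarrow>
      \<exists>d Z Dr. Z \<subseteq> X \<and> Z \<noteq> {} \<and> 2 * card Z \<le> card X \<and> separates d X Z Dr \<and> cost Dr \<le> th * card Z"
    and W: "finite W"
  shows "X \<subseteq> W \<Longrightarrow> card X \<le> 2 ^ n \<Longrightarrow> \<exists>Dr r. (\<forall>a<length Ps. \<forall>x\<in>X - Dr a. \<forall>y\<in>X - Dr a. prec (Ps ! a) x y \<longrightarrow> r x < (r y :: nat))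
    \<and> cost (\<lambda>a. Dr a \<inter> X) \<le> th * n * card X"
proof (induction "card X" arbitrary: X n rule: less_induct)
  case less
  have finX: "finite X" using less.prems W finite_subset by blast
  show ?case
  proof (cases "\<exists>t<length Ps. \<exists>u\<in>X. \<exists>v\<in>X. prec (Ps ! t) u v")
    case False
    then show ?thesis by (rule_tac exI[of _ "\<lambda>_. {}"]) (auto simp: cost_def)
  next
    case True
    then obtain t u v where "t < length Ps" "prec (Ps ! t) u v" "u \<in> X" "v \<in> X" by blast
    from cut[OF less.prems(1) this] obtain d Z D0 where Z: "Z \<subseteq> X" "Z \<noteq> {}" "2 * card Z \<le> card X"
      and sep: "separates d X Z D0" and c0: "cost D0 \<le> th * card Z" by blast
    have finZ: "finite Z" using Z finX finite_subset by blast
    then have Zpos: "0 < card Z" using Z(2) by (simp add: card_gt_0_iff)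
    have cX: "card X = card Z + card (X - Z)" using Z finX finZ by (simp add: card_Diff_subset card_mono)
    obtain n' where n: "n = Suc n'" using Z(3) Zpos less.prems(2) by (cases n) auto
    have "card Z < card X" "card Z \<le> 2 ^ n'" using Z(3) Zpos less.prems(2) n by auto
    from less.hyps[OF this(1) _ this(2)] obtain D1 r1 where
      r1: "\<forall>a<length Ps. \<forall>x\<in>Z - D1 a. \<forall>y\<in>Z - D1 a. prec (Ps ! a) x y \<longrightarrow> r1 x < (r1 y :: nat)"
      and c1: "cost (\<lambda>a. D1 a \<inter> Z) \<le> th * n' * card Z" using Z less.prems(1) by blast
    have "card (X - Z) < card X" "card (X - Z) \<le> 2 ^ n" using cX Zpos less.prems(2) by auto
    from less.hyps[OF this(1) _ this(2)] obtain D2 r2 where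
      r2: "\<forall>a<length Ps. \<forall>x\<in>X - Z - D2 a. \<forall>y\<in>X - Z - D2 a. prec (Ps ! a) x y \<longrightarrow> r2 x < (r2 y :: nat)"
      and c2: "cost (\<lambda>a. D2 a \<inter> (X - Z)) \<le> th * n * card (X - Z)" using less.prems(1) by blast
    define K where "K = Suc (\<Sum>x\<in>X. r1 x + r2 x)"
    have K: "r1 x < K" "r2 x < K" if "x \<in> X" for x
      using member_le_sum[OF that, of "\<lambda>x. r1 x + r2 x"] finX by (auto simp: K_def)
    \<comment> \<open>The sides get disjoint blocks of ranks. If \<open>d\<close> holds, no
      surviving pair leads from \<open>Z\<close> to the rest, so \<open>Z\<close> goes on top;
      otherwise the rest does.\<close>
    define r where "r = (\<lambda>x. (if x \<in> Z then r1 x else r2 x) + (if (x \<in> Z) = d then K else 0))"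
    define Dr where "Dr = (\<lambda>a. D0 a \<union> D1 a \<inter> Z \<union> D2 a \<inter> (X - Z))"
    have "r x < r y" if a: "a < length Ps" and x: "x \<in> X - Dr a" and y: "y \<in> X - Dr a" and xy: "prec (Ps ! a) x y" for a x y
    proof -
      have s: "\<not> hop d a z w" if "z \<in> Z - D0 a" "w \<in> X - Z - D0 a" for z w
        using sep a that by (auto simp: separates_def)
      consider "x \<in> Z" "y \<in> Z" | "x \<notin> Z" "y \<notin> Z" | "x \<in> Z" "y \<notin> Z" | "x \<notin> Z" "y \<in> Z" by blast
      then show ?thesis
      proof cases
        case 1
        then have "r1 x < r1 y" using r1 a x y xy by (auto simp: Dr_def)
        then show ?thesis using 1 by (simp add: r_def)
      next
        case 2
        then have "r2 x < r2 y" using r2 a x y xy by (auto simp: Dr_def)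
        then show ?thesis using 2 by (simp add: r_def)
      next
        case 3
        then have "\<not> hop d a x y" using s[of x y] x y by (auto simp: Dr_def)
        then have "\<not> d" using xy by (auto simp: hop_def)
        then show ?thesis using 3 K[of x] x by (simp add: r_def)
      next
        case 4
        then have "\<not> hop d a y x" using s[of y x] x y by (auto simp: Dr_def)
        then have "d" using xy by (auto simp: hop_def split: if_splits)
        then show ?thesis using 4 K[of x] x by (simp add: r_def)
      qed
    qed
    moreover have "cost (\<lambda>a. Dr a \<inter> X) \<le> th * n * card X"
    proof -
      have "cost (\<lambda>a. Dr a \<inter> X) \<le> cost D0 + cost (\<lambda>a. D1 a \<inter> Z) + cost (\<lambda>a. D2 a \<inter> (X - Z))"
        unfolding cost_def sum.distrib[symmetric]
      proof (rule sum_mono)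
        fix a
        have "card (Dr a \<inter> X \<inter> set (Ps ! a)) \<le> card (D0 a \<inter> set (Ps ! a) \<union> D1 a \<inter> Z \<inter> set (Ps ! a) \<union> D2 a \<inter> (X - Z) \<inter> set (Ps ! a))"
          by (intro card_mono) (auto simp: Dr_def)
        also have "\<dots> \<le> card (D0 a \<inter> set (Ps ! a) \<union> D1 a \<inter> Z \<inter> set (Ps ! a)) + card (D2 a \<inter> (X - Z) \<inter> set (Ps ! a))"
          by (rule card_Un_le)
        also have "\<dots> \<le> card (D0 a \<inter> set (Ps ! a)) + card (D1 a \<inter> Z \<inter> set (Ps ! a)) + card (D2 a \<inter> (X - Z) \<inter> set (Ps ! a))"
          by (intro add_right_mono card_Un_le)
        finally show "card (Dr a \<inter> X \<inter> set (Ps ! a)) \<le> card (D0 a \<inter> set (Ps ! a)) + card (D1 a \<inter> Z \<inter> set (Ps ! a)) + card (D2 a \<inter> (X - Z) \<inter> set (Ps ! a))" .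
      qed
      also have "\<dots> \<le> th * card Z + th * n' * card Z + th * n * card (X - Z)" using c0 c1 c2 by linarith
      also have "\<dots> = th * n * card X" unfolding cX n by (simp add: algebra_simps)
      finally show ?thesis .
    qed
    ultimately show ?thesis by (rule_tac exI[of _ Dr], rule_tac exI[of _ r]) blast
  qed
qed

end

section \<open>Acyclic subsystems and the main theorem\<close>

lemma bridgeless_subsystem:
  assumes "bridgeless Ps" "length Qs = length Ps"
    and "\<And>i x y. i < length Ps \<Longrightarrow> prec (Qs ! i) x y \<Longrightarrow> prec (Ps ! i) x y"
  shows "bridgeless Qs"
  unfolding bridgeless_def
proof (intro allI notI)
  fix b assume "has_bridge Qs b"
  then obtain v idx where b: "1 \<le> b" "inj_on v {..<b}" "inj_on idx {..<b}" "\<forall>j<b. idx j < length Qs"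
    "\<forall>j. j + 1 < b \<longrightarrow> prec (Qs ! idx j) (v j) (v (j + 1))"
    "prec (Qs ! idx (b - 1)) (v 0) (v (b - 1))"
    unfolding has_bridge_def by blast
  have "idx (b - 1) < length Ps" "\<forall>j<b. idx j < length Ps" using b(1,4) assms(2) by auto
  moreover from this have "\<forall>j. j + 1 < b \<longrightarrow> prec (Ps ! idx j) (v j) (v (j + 1))"
    "prec (Ps ! idx (b - 1)) (v 0) (v (b - 1))" using assms(3) b(5,6) by auto
  ultimately have "has_bridge Ps b" unfolding has_bridge_def using b(1-3) by blast
  then show False using assms(1) by (simp add: bridgeless_def)
qed

lemma ps_size_conv_sum: "ps_size Ps = (\<Sum>a<length Ps. length (Ps ! a))"
  unfolding ps_size_def by (simp add: sum_list_sum_nth atLeast0LessThan)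

text \<open>The graph of a system of size \<open>s\<close> has more than \<open>2 * s\<close>
  vertices, so the system is shortened to fit into \<open>beta n n \<infinity>\<close> of
  them.\<close>

lemma trim_to_size:
  "s \<le> ps_size Ps \<Longrightarrow> \<exists>Qs. length Qs = length Ps \<and> ps_size Qs = s \<and>
     (\<forall>i<length Ps. \<exists>m. Qs ! i = take m (Ps ! i))"
proof (induction Ps arbitrary: s)
  case (Cons vs Ps)
  define r where "r = min s (ps_size Ps)"
  from Cons.IH[of r] obtain Qs where Qs: "length Qs = length Ps" "ps_size Qs = r"
    "\<forall>i<length Ps. \<exists>m. Qs ! i = take m (Ps ! i)" by (auto simp: r_def)
  have "s - r \<le> length vs" using Cons.prems by (auto simp: r_def ps_size_def)
  then have "ps_size (take (s - r) vs # Qs) = s" using Qs(2) by (simp add: ps_size_def r_def)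
  moreover have "\<forall>i<length (vs # Ps). \<exists>m. (take (s - r) vs # Qs) ! i = take m ((vs # Ps) ! i)"
    using Qs(3) by (auto simp: less_Suc_eq_0_disj)
  ultimately show ?case using Qs(1) by (intro exI[of _ "take (s - r) vs # Qs"]) auto
qed (simp add: ps_size_def)

text \<open>Pigeonhole over the \<open>L\<close> dyadic ranges; nodes of degree 0 lie in none and
  contribute nothing.\<close>

lemma dyadic_degree_class:
  assumes "finite V" "0 < L" "\<And>w. w \<in> V \<Longrightarrow> deg w < 2 ^ L"
  obtains i where "i < L" "sum deg V \<le> L * sum deg {w \<in> V. 2 ^ i \<le> deg w \<and> deg w < 2 ^ (i + 1)}"
proof -
  define C where "C = (\<lambda>i. {w \<in> V. 2 ^ i \<le> deg w \<and> deg w < (2::nat) ^ (i + 1)})"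
  have "sum deg V \<le> (\<Sum>i<L. sum deg (C i))"
  proof -
    have "w \<in> (\<Union>i<L. C i)" if w: "w \<in> V" "deg w \<noteq> 0" for w
    proof -
      obtain i where i: "2 ^ i \<le> deg w" "deg w < 2 ^ (i + 1)"
        using ex_power_ivl1[of 2 "deg w"] w(2) by auto
      then have "(2::nat) ^ i < 2 ^ L" using assms(3)[OF w(1)] by linarith
      then show ?thesis using w(1) i by (auto simp: C_def)
    qed
    then have "deg w \<le> (\<Sum>i<L. if w \<in> C i then deg w else 0)" if "w \<in> V" for w
      using that member_le_sum[of _ "{..<L}" "\<lambda>i. if w \<in> C i then deg w else 0"]
      by (cases "deg w = 0") fastforce+
    then have "sum deg V \<le> (\<Sum>w\<in>V. \<Sum>i<L. if w \<in> C i then deg w else 0)" by (rule sum_mono)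
    also have "\<dots> = (\<Sum>i<L. \<Sum>w\<in>V. if w \<in> C i then deg w else 0)" by (rule sum.swap)
    also have "\<dots> = (\<Sum>i<L. sum deg (C i))"
    proof (rule sum.cong)
      fix i
      have "{w \<in> V. w \<in> C i} = C i" by (auto simp: C_def)
      then show "(\<Sum>w\<in>V. if w \<in> C i then deg w else 0) = sum deg (C i)"
        using sum.inter_filter[OF assms(1), of deg "\<lambda>w. w \<in> C i"] by simp
    qed simp
    finally show ?thesis .
  qed
  moreover have "\<exists>i<L. (\<Sum>i<L. sum deg (C i)) \<le> L * sum deg (C i)"
  proof (rule ccontr)
    assume "\<not> ?thesis"
    then have "L * sum deg (C i) < (\<Sum>i<L. sum deg (C i))" if "i < L" for i using that by (auto simp: not_le)
    then have "(\<Sum>i<L. L * sum deg (C i)) < (\<Sum>i<L. (\<Sum>i<L. sum deg (C i)))"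
      using assms(2) by (intro sum_strict_mono) auto
    then show False by (simp add: sum_distrib_left)
  qed
  ultimately show ?thesis using that unfolding C_def by (meson order_trans)
qed

lemma acyclic_extraction:
  assumes ps: "path_system V Ps" and n: "card V = n" "length Ps = n" "0 < n" "n < 2 ^ L"
    and bl: "bridgeless Ps" and big: "10000 * n * L ^ 6 \<le> ps_size Ps"
  obtains Qs rank where "length Qs = n" "acyclic_system Qs rank" "path_system V Qs" "ps_size Ps \<le> 2 * L * ps_size Qs"
proof -
  have V: "finite V" and dist: "\<forall>vs\<in>set Ps. distinct vs" and sub: "\<And>a. a < n \<Longrightarrow> set (Ps ! a) \<subseteq> V"
    using ps n(2) by (auto simp: path_system_def)
  have L: "0 < L" using n(3,4) by (cases L) auto
  define deg where "deg = (\<lambda>w. card {a \<in> {..<n}. w \<in> set (Ps ! a)})"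
  have swap: "sum deg W = (\<Sum>a<n. card {w \<in> W. w \<in> set (Ps ! a)})" if "finite W" for W
    unfolding deg_def using that by (intro sum_card_swap) auto
  have "ps_size Ps = sum deg V"
  proof -
    have "{w \<in> V. w \<in> set (Ps ! a)} = set (Ps ! a)" if "a < n" for a using sub[OF that] by auto
    moreover have "card (set (Ps ! a)) = length (Ps ! a)" if "a < n" for a
      using that dist n(2) by (simp add: distinct_card)
    ultimately show ?thesis using swap[OF V] n(2) by (simp add: ps_size_conv_sum)
  qed
  have "deg w \<le> card {..<n}" for w unfolding deg_def by (rule card_mono) auto
  then have degn: "deg w \<le> n" for w by simp
  then have "deg w < 2 ^ L" for w using n(4) le_less_trans by blast
  then obtain i where i: "i < L"
    and heavy: "sum deg V \<le> L * sum deg {w \<in> V. 2 ^ i \<le> deg w \<and> deg w < 2 ^ (i + 1)}"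
    using dyadic_degree_class[OF V L, of deg] by blast
  define W where "W = {w \<in> V. 2 ^ i \<le> deg w \<and> deg w < 2 ^ (i + 1)}"
  define D :: nat where "D = 2 ^ (i + 1)"
  define S where "S = sum deg W"
  have W: "finite W" "W \<subseteq> V" using V by (auto simp: W_def)
  then have cW: "card W \<le> n" using card_mono[OF V] n(1) by blast
  have "ps_size Ps \<le> L * S" using heavy \<open>ps_size Ps = sum deg V\<close> by (simp add: S_def W_def)
  have "S \<le> (\<Sum>w\<in>W. D)" unfolding S_def by (rule sum_mono) (auto simp: W_def D_def)
  then have SD: "S \<le> card W * D" by simp
  have "(\<Sum>w\<in>W. D) \<le> (\<Sum>w\<in>W. 2 * deg w)" by (rule sum_mono) (auto simp: W_def D_def)
  then have DS: "card W * D \<le> 2 * S" by (simp add: S_def sum_distrib_left)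
  \<comment> \<open>The size is at most \<open>L * S\<close>, and \<open>S\<close> is at most
    \<open>n * D\<close>.\<close>
  have D: "10000 * L ^ 5 \<le> D"
  proof -
    have "n * L * (10000 * L ^ 5) = 10000 * n * L ^ 6" by (simp add: power_numeral_reduce)
    also have "\<dots> \<le> L * S" using big \<open>ps_size Ps \<le> L * S\<close> by linarith
    also have "\<dots> \<le> L * (n * D)"
      by (intro mult_left_mono order_trans[OF SD] mult_right_mono cW) auto
    finally have "n * L * (10000 * L ^ 5) \<le> n * L * D" by (simp add: mult_ac)
    then show ?thesis using n(3) L by simp
  qed
  \<comment> \<open>\<open>k\<close> and \<open>m\<close> come from \<open>balanced_classes\<close>.
    With this \<open>th\<close>, the at most \<open>L\<close> charges per node delete at most a
    quarter of \<open>card W * D\<close>; \<open>G\<close> makes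
    \<open>2 * k * m \<le> G * th\<close> follow from \<open>th8\<close>.\<close>
  define k m th G where "k = 3 * L" and "m = 2 * D" and "th = D div (4 * L)" and "G = 96 * L ^ 2"
  have pw: "L \<le> L ^ 5" "L ^ 3 \<le> L ^ 5" "1 \<le> L ^ 4" using L by (auto intro: self_le_power power_increasing)
  have th8: "D \<le> 8 * L * th"
  proof -
    have "D = 4 * L * th + D mod (4 * L)" unfolding th_def by simp
    moreover have "D mod (4 * L) < 4 * L" using L by simp
    ultimately have "D \<le> 4 * L * th + 4 * L" by linarith
    moreover have "8 * L \<le> D" using D pw(1) by linarith
    ultimately have "8 * L \<le> 4 * L * th + 4 * L" by linarith
    then have "4 * L * 1 \<le> 4 * L * th" by linarith
    then show ?thesis using \<open>D \<le> 4 * L * th + 4 * L\<close> by linarith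
  qed
  have th4: "4 * L * th \<le> D" unfolding th_def by simp
  have "8 * L * (1154 * L ^ 4) \<le> 8 * L * th"
  proof -
    have "8 * L * (1154 * L ^ 4) = 9232 * L ^ 5" by (simp add: power_numeral_reduce)
    then show ?thesis using D th8 by linarith
  qed
  then have "1154 * L ^ 4 \<le> th" using L by simp
  moreover have "2 * (2 * (G * L) * k + 1) = 1152 * L ^ 4 + 2"
    by (simp add: G_def k_def power_numeral_reduce)
  ultimately have th: "2 * (2 * (G * L) * k + 1) \<le> th" using pw(3) by linarith
  have "2 * k * m = 12 * L * D" by (simp add: k_def m_def)
  also have "\<dots> \<le> 12 * L * (8 * L * th)" using th8 by (intro mult_left_mono) auto
  also have "\<dots> = G * th" by (simp add: G_def power2_eq_square)
  finally have G: "2 * k * m \<le> G * th" .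
  have "2 * (G * L) = 192 * L ^ 3" by (simp add: G_def power_numeral_reduce)
  then have m: "2 * (G * L) < m" using D pw(2) L zero_less_power[OF L, of 5] unfolding m_def by linarith
  have W2D: "card W * (2 * D) < 2 ^ k"
  proof -
    have "card W * (2 * D) \<le> n * (2 * 2 ^ L)"
      using cW i unfolding D_def by (intro mult_mono power_increasing) auto
    also have "\<dots> < 2 ^ L * (2 * 2 ^ L)" using n(4) by (intro mult_strict_right_mono) auto
    also have "\<dots> = 2 ^ (2 * L + 1)" by (simp add: mult_2 power_add distrib_left)
    also have "\<dots> \<le> 2 ^ k" using L unfolding k_def by (intro power_increasing) auto
    finally show ?thesis .
  qed
  have degD: "card {a \<in> {..<n}. w \<in> set (Ps ! a)} \<le> D" if "w \<in> W" for w
  proof -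
    have "deg w \<le> D" using that by (simp add: W_def D_def)
    then show ?thesis by (simp add: deg_def)
  qed
  have "0 < D" by (simp add: D_def)
  obtain cls :: "nat \<Rightarrow> nat" where cls: "\<And>a. cls a < 2 * D"
    "\<And>w j. w \<in> W \<Longrightarrow> card {a \<in> {..<n}. w \<in> set (Ps ! a) \<and> cls a = j} < k"
  proof (rule balanced_classes[where p = n and R = "\<lambda>w a. w \<in> set (Ps ! a)", OF W(1) \<open>0 < D\<close> _ W2D])
    show "card {a \<in> {..<n}. w \<in> set (Ps ! a)} \<le> D" if "w \<in> W" for w by (rule degD[OF that])
  qed (rule that)
  have cut: "\<exists>d Z Dr. Z \<subseteq> X \<and> Z \<noteq> {} \<and> 2 * card Z \<le> card X \<and> separates Ps d X Z Dr \<and> cost Ps Dr \<le> th * card Z"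
    if "X \<subseteq> W" "t < length Ps" "prec (Ps ! t) u v" "u \<in> X" "v \<in> X" for X t u v
  proof (rule sparse_cut_exists[OF bl dist _ that(1) _ that(2-5) cls(1)[folded m_def] _ _ th G _ m])
    show "finite X" using that(1) W(1) finite_subset by blast
    have "card X \<le> n" using card_mono[OF W(1) that(1)] cW by linarith
    then show "card X < 2 ^ L" using n(4) by linarith
    show "0 < k" "0 < G" using L by (auto simp: k_def G_def)
    show "card {a \<in> {..<length Ps}. w \<in> set (Ps ! a) \<and> cls a = j} \<le> k" if "w \<in> W" for w j
      using cls(2)[OF that] n(2) by (simp add: less_imp_le)
  qed
  obtain Dr r where r: "\<forall>a<length Ps. \<forall>x\<in>W - Dr a. \<forall>y\<in>W - Dr a. prec (Ps ! a) x y \<longrightarrow> r x < (r y :: nat)"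
    and loss: "cost Ps (\<lambda>a. Dr a \<inter> W) \<le> th * L * card W"
  proof -
    have "\<exists>Dr r. (\<forall>a<length Ps. \<forall>x\<in>W - Dr a. \<forall>y\<in>W - Dr a. prec (Ps ! a) x y \<longrightarrow> r x < (r y :: nat))
        \<and> cost Ps (\<lambda>a. Dr a \<inter> W) \<le> th * L * card W"
    proof (rule acyclic_rank[OF _ W(1) order_refl])
      show "card W \<le> 2 ^ L" using cW n(4) by linarith
    qed (rule cut)
    then show ?thesis using that by blast
  qed
  define Qs where "Qs = map (\<lambda>a. filter (\<lambda>x. x \<in> W - Dr a) (Ps ! a)) [0..<n]"
  have lenQ: "length Qs = n" and nthQ: "\<And>a. a < n \<Longrightarrow> Qs ! a = filter (\<lambda>x. x \<in> W - Dr a) (Ps ! a)"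
    by (auto simp: Qs_def)
  have "bridgeless Qs"
  proof (rule bridgeless_subsystem[OF bl])
    show "length Qs = length Ps" using lenQ n(2) by simp
    show "prec (Ps ! a) x y" if "a < length Ps" "prec (Qs ! a) x y" for a x y
      by (rule prec_filter[where P = "\<lambda>x. x \<in> W - Dr a"]) (use that n(2) nthQ in simp)
  qed
  moreover have "r x < r y" if "a < length Qs" "prec (Qs ! a) x y" for a x y
  proof -
    have a: "a < n" using that(1) lenQ by simp
    have "prec (filter (\<lambda>x. x \<in> W - Dr a) (Ps ! a)) x y" using that(2) nthQ[OF a] by simp
    note prec_filter[OF this] prec_filterD[OF this]
    then show ?thesis using r a n(2) by blast
  qed
  ultimately have "acyclic_system Qs r" by unfold_locales
  moreover have "path_system V Qs" unfolding path_system_def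
  proof (intro conjI V ballI)
    fix vs assume "vs \<in> set Qs"
    then obtain a where a: "a < n" "vs = filter (\<lambda>x. x \<in> W - Dr a) (Ps ! a)" by (auto simp: Qs_def)
    then show "distinct vs" "set vs \<subseteq> V" using dist n(2) W(2) by auto
  qed
  moreover have "ps_size Ps \<le> 2 * L * ps_size Qs"
  proof -
    have "S = (\<Sum>a<n. card {w \<in> W. w \<in> set (Ps ! a)})" unfolding S_def by (rule swap[OF W(1)])
    also have "\<dots> \<le> (\<Sum>a<n. length (Qs ! a) + card (Dr a \<inter> W \<inter> set (Ps ! a)))"
    proof (rule sum_mono)
      fix a assume "a \<in> {..<n}"
      then have "a < n" by simp
      then have d: "distinct (Qs ! a)" using nthQ dist n(2) by simp
      have "card {w \<in> W. w \<in> set (Ps ! a)} \<le> card (set (Qs ! a) \<union> (Dr a \<inter> W \<inter> set (Ps ! a)))"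
        using nthQ[OF \<open>a < n\<close>] by (intro card_mono) auto
      also have "\<dots> \<le> card (set (Qs ! a)) + card (Dr a \<inter> W \<inter> set (Ps ! a))" by (rule card_Un_le)
      finally show "card {w \<in> W. w \<in> set (Ps ! a)} \<le> length (Qs ! a) + card (Dr a \<inter> W \<inter> set (Ps ! a))"
        using distinct_card[OF d] by simp
    qed
    also have "\<dots> = ps_size Qs + cost Ps (\<lambda>a. Dr a \<inter> W)"
      unfolding ps_size_conv_sum cost_def lenQ n(2) by (rule sum.distrib)
    finally have "4 * S \<le> 4 * ps_size Qs + 4 * (th * L * card W)" using loss by linarith
    \<comment> \<open>The loss is at most \<open>card W * D / 4\<close>, hence at most
      \<open>S / 2\<close>, because degrees in the class are at least \<open>D / 2\<close>.\<close>
    moreover have "4 * (th * L * card W) \<le> card W * D"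
      using mult_right_mono[OF th4, of "card W"] by (simp add: mult_ac)
    ultimately have "S \<le> 2 * ps_size Qs" using DS by linarith
    then have "L * S \<le> L * (2 * ps_size Qs)" by (rule mult_left_mono) simp
    then show ?thesis using \<open>ps_size Ps \<le> L * S\<close> by linarith
  qed
  ultimately show ?thesis using that lenQ by blast
qed

lemma MCG_beta_lower_bound:
  assumes n: "0 < n" "n < 2 ^ L" and big: "10000 * n * L ^ 6 \<le> beta n n \<infinity>"
  shows "beta n n \<infinity> \<le> 8192 * n * L * MCG (beta n n \<infinity>)"
proof -
  define B where "B = beta n n \<infinity>"
  obtain V Ps where Ps: "path_system V Ps" "card V = n" "length Ps = n" "bridgeless Ps" "ps_size Ps = B"
    unfolding B_def by (rule beta_attained)
  have L: "0 < L" using n by (cases L) auto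
  obtain Rs rank where Rs: "length Rs = n" "acyclic_system Rs rank" "path_system V Rs" "B \<le> 2 * L * ps_size Rs"
  proof (rule acyclic_extraction[OF Ps(1-3) n Ps(4)])
    show "10000 * n * L ^ 6 \<le> ps_size Ps" using big Ps(5) by (simp add: B_def)
  qed (simp add: Ps(5))
  have B: "10000 * n * L \<le> B"
  proof -
    have "10000 * n * L \<le> 10000 * n * L ^ 6" using L by (intro mult_left_mono self_le_power) auto
    then show ?thesis using big unfolding B_def by (rule order_trans)
  qed
  \<comment> \<open>Small enough that \<open>Rs\<close> has at least this size and that the graph
    has at most \<open>B\<close> vertices.\<close>
  define s where "s = B div (8 * L)"
  have s8: "8 * L * s \<le> B" unfolding s_def by simp
  have s16: "B < 8 * L * (s + 1)"
  proof -
    have "B = 8 * L * s + B mod (8 * L)" unfolding s_def by simp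
    moreover have "B mod (8 * L) < 8 * L" using L by simp
    ultimately show ?thesis by (simp only: distrib_left)
  qed
  have "8 * L * (1250 * n) \<le> B" using B by (simp add: mult_ac)
  then have "8 * L * (1250 * n) < 8 * L * (s + 1)" using s16 by linarith
  then have "1250 * n < s + 1" by (rule mult_less_cancel1[THEN iffD1, THEN conjunct2])
  then have sn: "1250 * n \<le> s" by simp
  have "2 * L * (4 * s) \<le> 2 * L * ps_size Rs" using s8 Rs(4) by linarith
  then have "s \<le> ps_size Rs" using L by simp
  then obtain Qs where Qs: "length Qs = n" "ps_size Qs = s" "\<forall>i<n. \<exists>m. Qs ! i = take m (Rs ! i)"
    using trim_to_size Rs(1) by blast
  interpret R: acyclic_system Rs rank by (rule Rs(2))
  have prec: "prec (Rs ! i) x y" if i: "i < n" and xy: "prec (Qs ! i) x y" for i x y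
  proof -
    obtain m where "Qs ! i = take m (Rs ! i)" using Qs(3) i by blast
    then show ?thesis using prec_take[of m "Rs ! i" x y] xy by simp
  qed
  have "acyclic_system Qs rank"
  proof
    show "bridgeless Qs" by (rule bridgeless_subsystem[OF R.bridgeless]) (simp_all add: Qs(1) Rs(1) prec)
    show "rank x < rank y" if "i < length Qs" "prec (Qs ! i) x y" for i x y
      using R.rank[OF _ prec] that Qs(1) Rs(1) by simp
  qed
  have Qprops: "distinct vs \<and> set vs \<subseteq> V" if vs: "vs \<in> set Qs" for vs
  proof -
    obtain i where i: "i < n" "vs = Qs ! i" using vs Qs(1) by (metis in_set_conv_nth)
    then obtain m where "vs = take m (Rs ! i)" using Qs(3) by blast
    moreover have "distinct (Rs ! i)" "set (Rs ! i) \<subseteq> V" using Rs(1,3) i by (auto simp: path_system_def)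
    ultimately show ?thesis using set_take_subset by fastforce
  qed
  \<comment> \<open>The largest level count that \<open>MCG_lower_bound\<close> admits for
    \<open>n\<close> nodes and \<open>n\<close> paths; \<open>sn\<close> makes it positive, so
    rounding costs at most a factor 2.\<close>
  define l where "l = s div (32 * n)"
  have l32: "32 * l * n \<le> s" unfolding l_def using div_times_less_eq_dividend[of s "32 * n"] by (simp add: mult_ac)
  have "s < 32 * n * (l + 1)"
  proof -
    have "s = 32 * n * l + s mod (32 * n)" unfolding l_def by simp
    moreover have "s mod (32 * n) < 32 * n" using n by simp
    ultimately show ?thesis by (simp only: distrib_left)
  qed
  moreover from this have "0 < l" using sn n(1) by (cases l) auto
  ultimately have l64: "s \<le> 64 * n * l"
  proof -
    have "32 * n * (l + 1) \<le> 32 * n * (2 * l)" using \<open>0 < l\<close> by (intro mult_left_mono) auto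
    then show ?thesis using \<open>s < 32 * n * (l + 1)\<close> by linarith
  qed
  have "l \<le> 8 * MCG B"
  proof (rule MCG_lower_bound[OF \<open>acyclic_system Qs rank\<close>])
    show "\<forall>vs\<in>set Qs. distinct vs" using Qprops by blast
    show "0 < l" by fact
    have "card (set (concat Qs)) \<le> n"
      using Qprops Ps(1,2) card_mono[of V "set (concat Qs)"] by (force simp: path_system_def)
    then have "32 * l * card (set (concat Qs)) \<le> 32 * l * n" by (intro mult_left_mono) auto
    then show "32 * l * card (set (concat Qs)) \<le> ps_size Qs" using l32 Qs(2) by linarith
    show "32 * l * length Qs \<le> ps_size Qs" using l32 Qs by simp
    show "0 < ps_size Qs" using sn n(1) Qs(2) by linarith
    have "8 * 1 * s \<le> 8 * L * s" using L by (intro mult_right_mono) auto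
    then show "2 * ps_size Qs + 2 * length Qs \<le> B" using s8 sn Qs by linarith
  qed
  have "B \<le> 8 * L * (2 * s)"
  proof -
    have "8 * L * (s + 1) \<le> 8 * L * (2 * s)" using sn n(1) by (intro mult_left_mono) auto
    then show ?thesis using s16 by linarith
  qed
  also have "\<dots> \<le> 8 * L * (2 * (64 * n * (8 * MCG B)))"
    using l64 \<open>l \<le> 8 * MCG B\<close> by (intro mult_left_mono) (auto intro: order_trans)
  finally show ?thesis by (simp add: B_def mult_ac)
qed

section \<open>Asymptotics\<close>

lemma beta_eventually_large: "\<forall>\<^sub>F n in sequentially. 10000 * real n * (4 * ln (real n)) ^ 6 \<le> real (beta n n \<infinity>)"
proof -
  have "\<forall>\<^sub>F n::nat in sequentially. 10000 * real n * (4 * ln (real n)) ^ 6 \<le> 256 * ((real n / 256) powr (1/6) - 1) ^ 7"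
    by real_asymp
  moreover have "\<forall>\<^sub>F n::nat in sequentially. 1 \<le> (real n / 256) powr (1/6)" by real_asymp
  ultimately show ?thesis
  proof eventually_elim
    case (elim n)
    define x where "x = (real n / 256) powr (1/6)"
    \<comment> \<open>The largest \<open>q\<close> with \<open>256 * q ^ 6 \<le> n\<close>. Then
      \<open>256 * q ^ 7\<close> has order \<open>n powr (7/6)\<close>, which beats \<open>n\<close>
      times any power of the logarithm.\<close>
    define q where "q = nat \<lfloor>x\<rfloor>"
    have q: "x - 1 \<le> real q" "real q \<le> x" using elim(2) unfolding q_def x_def by linarith+
    have "0 < real n / 256" using elim(2) by (cases "n = 0") auto
    then have "x ^ 6 = real n / 256" by (simp add: x_def powr_powr flip: powr_numeral)
    then have "real (256 * q ^ 6) \<le> real n" using power_mono[OF q(2), of 6] by simp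
    then have "256 * q ^ 7 \<le> beta n n \<infinity>" by (intro beta_lower_bound) linarith
    then have "256 * real q ^ 7 \<le> real (beta n n \<infinity>)" by (metis of_nat_le_iff of_nat_mult of_nat_numeral of_nat_power)
    moreover have "256 * (x - 1) ^ 7 \<le> 256 * real q ^ 7"
      using q(1) elim(2) by (intro mult_left_mono power_mono) (auto simp: x_def)
    ultimately show ?case using elim(1) by (simp add: x_def)
  qed
qed

theorem theorem5p2:
  shows "(\<lambda>n::nat. real (MCG (beta n n \<infinity>)))
           \<in> \<Omega>(\<lambda>n::nat. real (beta n n \<infinity>) / (real n * ln (real n)))"
proof (rule landau_omega.bigI[where c = "1/32768"])
  show "\<forall>\<^sub>F n in sequentially. 1 / 32768 * norm (real (beta n n \<infinity>) / (real n * ln (real n)))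
      \<le> norm (real (MCG (beta n n \<infinity>)))"
    using beta_eventually_large eventually_ge_at_top[of "2::nat"]
  proof eventually_elim
    case (elim n)
    obtain i where i: "2 ^ i \<le> n" "n < 2 ^ (i + 1)" using ex_power_ivl1[of 2 n] elim(2) by auto
    define L where "L = i + 1"
    have "1 \<le> i" using i(2) elim(2) by (cases i) auto
    have pos: "0 < ln (real n)" "0 < real n" using elim(2) by auto
    \<comment> \<open>From \<open>L \<le> 2 * i\<close> and \<open>ln 2 \<ge> 1/2\<close>; this
      factor 4 turns 8192 into 32768.\<close>
    have "real L \<le> 4 * ln (real n)"
    proof -
      have "real (2 ^ i) \<le> real n" using i(1) by (simp only: of_nat_le_iff)
      then have "ln (2 ^ i) \<le> ln (real n)" using pos by (subst ln_le_cancel_iff) auto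
      then have "real i * ln 2 \<le> ln (real n)" by (simp add: ln_realpow)
      moreover have "real i * (1 / 2) \<le> real i * ln 2"
        using ln_le_minus_one[of "1 / 2"] by (intro mult_left_mono) (auto simp: ln_div)
      ultimately show ?thesis using \<open>1 \<le> i\<close> unfolding L_def by linarith
    qed
    have "10000 * real n * real L ^ 6 \<le> 10000 * real n * (4 * ln (real n)) ^ 6"
      using \<open>real L \<le> _\<close> by (intro mult_left_mono power_mono) auto
    then have "real (10000 * n * L ^ 6) \<le> real (beta n n \<infinity>)" using elim(1) by simp
    then have "10000 * n * L ^ 6 \<le> beta n n \<infinity>" by (simp only: of_nat_le_iff)
    moreover have "0 < n" using elim(2) by simp
    ultimately have "beta n n \<infinity> \<le> 8192 * n * L * MCG (beta n n \<infinity>)"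
      using i(2) by (intro MCG_beta_lower_bound) (simp_all only: L_def)
    then have "real (beta n n \<infinity>) \<le> real (8192 * n * L * MCG (beta n n \<infinity>))"
      by (simp only: of_nat_le_iff)
    also have "\<dots> = 8192 * real n * real L * real (MCG (beta n n \<infinity>))" by simp
    also have "\<dots> \<le> 8192 * real n * (4 * ln (real n)) * real (MCG (beta n n \<infinity>))"
      using \<open>real L \<le> _\<close> by (intro mult_right_mono mult_left_mono) auto
    finally have "real (beta n n \<infinity>) / (real n * ln (real n)) \<le> 32768 * real (MCG (beta n n \<infinity>))"
      using pos by (simp add: pos_divide_le_eq mult_ac)
    moreover have "0 \<le> real (beta n n \<infinity>) / (real n * ln (real n))" using pos by simp
    ultimately show ?case by (simp only: real_norm_def abs_of_nonneg of_nat_0_le_iff)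
  qed
qed simp

end
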